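(* Suppose that $X_i\mid\theta_i\overset{ind}{\sim}N(\theta_i,1)$ and $\theta_i\overset{iid}{\sim}G^*$ for $i=1,\dots,n$, with $G^*\in\mathcal P(\mathbb R)$, so that $X_1,\dots,X_n$ are i.i.d. with density $p_{G^*}(x)=\int\phi(x-\theta)\,dG^*(\theta)$. Let $c_*>0$, $L>0$, and $\mathcal F_L:=\{f_H:H\in\mathcal P([-L,L])\}$. Suppose that there exist $c_1,c_2>0$ such that $\int\mathbf 1(|x|>t)p_{G^*}(x)\,dx\le c_1e^{-c_2t}$ for all $t>0$, and that there exists $C>0$ such that $$\sup_{x\in\mathbb R}\frac{f_{\tilde H}(x)}{p_{G^*}(x)}\le C,$$ where $f_{\tilde H}=\operatorname*{argmin}_{f\in\mathcal F_L}\mathrm{KL}(p_{G^*}\parallel f)$, $\tilde H\in\mathcal P([-L,L])$. Let $\hat H_n$ be the nonparametric maximum likelihood estimator over $\mathcal F_L$, i.e. a maximizer of $\sum_{i=1}^n\log f_H(X_i)$ over $H\in\mathcal P([-L,L])$. Then, with $q_n:=(\log n)^4/n$, $$\|g_{\hat H_n}-g_{\tilde H}\|_{L_2}^2=O_p\big(q_n^{\alpha_*}\big),\qquad \mathrm{wTV}(\pi_{\hat H_n},\pi_{\tilde H})=O_p\Big(q_n^{\alpha_*/2}\log^{1/4}(q_n^{-1})\Big).$$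
   Context: $\mathcal P(A)$ is the set of Borel probability measures on $A\subseteq\mathbb R$; $\phi_\sigma$ is the $N(0,\sigma^2)$ density and $\phi=\phi_1$. With $c_*>0$ fixed, $\sigma_*^2:=1+c_*^2$, $\alpha_*:=c_*^2/\sigma_*^2$, and for $H\in\mathcal P(\mathbb R)$: $f_H(x):=\int\phi_{\sigma_*}(x-\xi)\,dH(\xi)$, $g_H(\theta):=\int\phi_{c_*}(\theta-\xi)\,dH(\xi)$, $\pi_H(\theta\mid x):=\phi(x-\theta)g_H(\theta)/f_H(x)$. The true density $p_{G^*}$ need not be of the form $f_H$. $\mathrm{KL}(p\parallel q)=\int p\log(p/q)$; under the tail assumption on $p_{G^*}$ the minimizer $f_{\tilde H}$ of $\mathrm{KL}(p_{G^*}\parallel\cdot)$ over $\mathcal F_L$ exists and $f_{\tilde H}$ and $\tilde H$ are unique. $\mathrm{TV}(f,g)=\frac12\int|f-g|$ and $$\mathrm{wTV}(\pi_{\hat H_n},\pi_{\tilde H}):=\int\mathrm{TV}(\pi_{\hat H_n}(\cdot\mid x),\pi_{\tilde H}(\cdot\mid x))\,f_{\tilde H}(x)\,dx.$$ $O_p$ is with respect to the law of the i.i.d. sample from $p_{G^*}$ as $n\to\infty$. *)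

theory Defs
  imports "HOL-Probability.Probability"
begin

text \<open>Probability measures on a Borel set \<open>A\<close> are encoded as Borel probability
  measures on the real line that give \<open>A\<close> mass one.\<close>

definition borel_probs :: "real set \<Rightarrow> real measure set" where
  "borel_probs A = {H. real_distribution H \<and> measure H A = 1}"

definition normal_mixture :: "real \<Rightarrow> real measure \<Rightarrow> real \<Rightarrow> real" where
  "normal_mixture \<sigma> H x = (\<integral>\<xi>. normal_density 0 \<sigma> (x - \<xi>) \<partial>H)"

definition sigma_star :: "real \<Rightarrow> real" where
  "sigma_star c = sqrt (1 + c\<^sup>2)"

definition alpha_star :: "real \<Rightarrow> real" where
  "alpha_star c = c\<^sup>2 / (sigma_star c)\<^sup>2"

definition p_dens :: "real measure \<Rightarrow> real \<Rightarrow> real" where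
  "p_dens G = normal_mixture 1 G"

definition f_dens :: "real \<Rightarrow> real measure \<Rightarrow> real \<Rightarrow> real" where
  "f_dens c H = normal_mixture (sigma_star c) H"

definition g_dens :: "real \<Rightarrow> real measure \<Rightarrow> real \<Rightarrow> real" where
  "g_dens c H = normal_mixture c H"

definition posterior :: "real \<Rightarrow> real measure \<Rightarrow> real \<Rightarrow> real \<Rightarrow> real" where
  "posterior c H x \<theta> = normal_density 0 1 (x - \<theta>) * g_dens c H \<theta> / f_dens c H x"

definition F_class :: "real \<Rightarrow> real \<Rightarrow> (real \<Rightarrow> real) set" where
  "F_class c L = f_dens c ` borel_probs {-L..L}"

text \<open>\<^const>\<open>KL_divergence\<close> integrates over its last argument, so the arguments are
  swapped here.\<close>

definition KL :: "(real \<Rightarrow> real) \<Rightarrow> (real \<Rightarrow> real) \<Rightarrow> real" where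
  "KL p q = KL_divergence (exp 1) (density lborel q) (density lborel p)"

lemma KL_eq_integral:
  assumes "p \<in> borel_measurable borel" "q \<in> borel_measurable borel"
    and "\<And>x. 0 \<le> p x" "\<And>x. 0 < q x"
  shows "KL p q = (\<integral>x. p x * ln (p x / q x) \<partial>lborel)"
proof -
  have "KL p q = (\<integral>x. p x * log (exp 1) (p x / q x) \<partial>lborel)"
    unfolding KL_def
    by (rule lborel.KL_density_density) (use assms in \<open>auto simp: less_imp_le less_imp_neq[symmetric]\<close>)
  then show ?thesis
    by (simp add: log_def)
qed

definition TV :: "(real \<Rightarrow> real) \<Rightarrow> (real \<Rightarrow> real) \<Rightarrow> real" where
  "TV f g = (\<integral>x. \<bar>f x - g x\<bar> \<partial>lborel) / 2"

definition wTV :: "real \<Rightarrow> real measure \<Rightarrow> real measure \<Rightarrow> real" where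
  "wTV c H H0 = (\<integral>x. TV (posterior c H x) (posterior c H0 x) * f_dens c H0 x \<partial>lborel)"

definition L2norm :: "(real \<Rightarrow> real) \<Rightarrow> real" where
  "L2norm h = sqrt (\<integral>x. (h x)\<^sup>2 \<partial>lborel)"

text \<open>A maximizer of the likelihood is selected pointwise, with no measurability in the
  sample assumed. So \<open>O\<^sub>p\<close> is read with outer probability: the exceptional set
  is contained in an event of small probability. For measurable \<open>Y n\<close> this is the usual
  notion.\<close>

definition bigO_p :: "'a measure \<Rightarrow> (nat \<Rightarrow> 'a \<Rightarrow> real) \<Rightarrow> (nat \<Rightarrow> real) \<Rightarrow> bool" where
  "bigO_p M Y a \<longleftrightarrow>
    (\<forall>\<epsilon>>0. \<exists>K. \<forall>\<^sub>F n in sequentially. \<exists>A\<in>sets M.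
       measure M A \<le> \<epsilon> \<and> {\<omega>\<in>space M. \<bar>Y n \<omega>\<bar> > K * a n} \<subseteq> A)"

definition is_npmle :: "real \<Rightarrow> real \<Rightarrow> nat \<Rightarrow> (nat \<Rightarrow> real) \<Rightarrow> real measure \<Rightarrow> bool" where
  "is_npmle c L n x H \<longleftrightarrow>
    is_arg_max (\<lambda>H. \<Sum>i<n. ln (f_dens c H (x i))) (\<lambda>H. H \<in> borel_probs {-L..L}) H"

definition q_rate :: "nat \<Rightarrow> real" where
  "q_rate n = (ln (real n))^4 / real n"

end

theory Submission
  imports Defs "HOL-Real_Asymp.Real_Asymp"
begin

text \<open>
  Write \<open>q = q_rate n\<close>. The heart of the matter is the rate \<open>q\<close> for the squared \<open>L\<^sub>2\<close> distance of the
  marginal densities \<open>f\<close> of the estimator and of the projection; the two claims follow from it by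
  analytic inequalities that hold for every pair of mixing measures on \<open>[-L, L]\<close>.

  The marginal densities. Mixtures form a convex class, so the projection satisfies a first-order
  condition: \<open>\<integral>p * f\<^sub>H / f\<^sub>0 \<le> 1\<close> for every mixture \<open>f\<^sub>H\<close>, where \<open>f\<^sub>0\<close> is the projection
  (\<open>KL_projection_ratio_le_1\<close>). Hence \<open>\<integral>p * sqrt (f\<^sub>H / f\<^sub>0)\<close> falls short of one by at least a Hellinger
  distance, and since \<open>f\<^sub>0 \<le> C * p\<close> by at least a multiple of the squared \<open>L\<^sub>2\<close> distance
  (\<open>nn_integral_sqrt_ratio_le\<close>). By independence and Markov's inequality, the likelihood of a fixed
  \<open>f\<^sub>H\<close> at squared distance \<open>B * q\<close> comes within a constant factor of that of \<open>f\<^sub>0\<close> only with a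
  probability of order \<open>exp (- b * n * q)\<close>, \<open>b\<close> a multiple of \<open>B\<close>. The exponential tail confines the sample to an interval of
  length \<open>O (ln n)\<close>, on which finitely many mixtures dominate all of them up to a factor \<open>1 + 1 / n\<close>,
  that is, up to a constant factor in the likelihood. Likelihood ratios of Gaussian mixtures are
  entire functions of exponential type, so \<open>O (ln n)\<close> rounded moments suffice, and the number of
  mixtures needed is \<open>exp (O ((ln n)\<^sup>2))\<close> (\<open>finite_likelihood_net\<close>). A union bound finishes this part
  (\<open>npmle_L2_rate\<close>), because \<open>n * q = (ln n)^4\<close>. The exceptional
  event mentions only the finitely many fixed mixtures, so it is measurable whatever the estimator is.

  From \<open>f\<close> to \<open>g\<close>. Both are convolutions of the same mixing measure with Gaussians, of different
  widths. On the Fourier side the squared distances are integrals of one function against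
  \<open>exp (- (1 + c\<^sup>2) * t\<^sup>2)\<close> and \<open>exp (- c\<^sup>2 * t\<^sup>2)\<close>, and a frequency cut-off interpolates between them
  (\<open>narrower_mixture_diff_sq_le\<close>). This is where the exponent \<open>c\<^sup>2 / (1 + c\<^sup>2)\<close> comes from.

  The posterior. As \<open>f\<close> is \<open>g\<close> smoothed by the noise density, the weighted total variation is at
  most the \<open>L\<^sub>1\<close> distance of the \<open>g\<close> (\<open>wTV_le_L1\<close>). The \<open>g\<close> have Gaussian tails, so Cauchy--Schwarz on
  an interval of length \<open>O (sqrt (ln (inverse q)))\<close> bounds it by the \<open>L\<^sub>2\<close> distance, at the cost of the
  fourth root of the logarithm (\<open>wTV_le_of_L2\<close>).
\<close>

section \<open>Gaussian mixtures\<close>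

lemma borel_probsD:
  assumes "H \<in> borel_probs A"
  shows "real_distribution H" "measure H A = 1"
  using assms by (auto simp: borel_probs_def)

lemma AE_borel_probs:
  assumes "H \<in> borel_probs A" "A \<in> sets borel"
  shows "AE \<xi> in H. \<xi> \<in> A"
proof -
  interpret real_distribution H using borel_probsD(1)[OF assms(1)] .
  show ?thesis using assms(2) borel_probsD(2)[OF assms(1)]
    by (subst AE_in_set_eq_1) auto
qed

lemma normal_density_le_peak:
  assumes "s > 0"
  shows "normal_density m s x \<le> normal_density 0 s 0"
  using assms by (auto simp: normal_density_def divide_simps)

lemma normal_density_peak_le_1:
  assumes "s \<ge> 1"
  shows "normal_density 0 s 0 \<le> 1"
proof -
  have "1 * 1 \<le> (2 * pi) * s\<^sup>2"
    using assms pi_gt3 by (intro mult_mono) (auto simp: one_le_power)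
  then have "1 \<le> sqrt ((2 * pi) * s\<^sup>2)" by simp
  then show ?thesis by (simp add: normal_density_def)
qed

lemma normal_density_uminus: "normal_density 0 s (- x) = normal_density 0 s x"
  by (simp add: normal_density_def)

context
  fixes H :: "real measure" and s :: real
  assumes H: "real_distribution H" and s: "s > 0"
begin

interpretation real_distribution H by (rule H)

lemma integrable_normal_kernel: "integrable H (\<lambda>\<xi>. normal_density 0 s (x - \<xi>))"
  by (rule integrable_const_bound[where B = "normal_density 0 s 0"])
     (auto intro!: normal_density_le_peak s)

lemma measurable_normal_mixture: "normal_mixture s H \<in> borel_measurable borel"
  unfolding normal_mixture_def[abs_def] by measurable

lemma ennreal_normal_mixture:
  "ennreal (normal_mixture s H x) = (\<integral>\<^sup>+\<xi>. ennreal (normal_density 0 s (x - \<xi>)) \<partial>H)"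
  unfolding normal_mixture_def
  by (rule nn_integral_eq_integral[symmetric]) (auto intro: integrable_normal_kernel)

lemma normal_mixture_pos: "normal_mixture s H x > 0"
proof -
  have "normal_mixture s H x \<noteq> 0"
    unfolding normal_mixture_def
    by (subst integral_nonneg_eq_0_iff_AE[OF integrable_normal_kernel])
       (auto simp: less_imp_neq[OF normal_density_pos[OF s], symmetric] AE_False)
  moreover have "normal_mixture s H x \<ge> 0"
    unfolding normal_mixture_def by (rule integral_nonneg_AE) simp
  ultimately show ?thesis by linarith
qed

lemma normal_mixture_le_peak: "normal_mixture s H x \<le> normal_density 0 s 0"
proof -
  have "normal_mixture s H x \<le> (\<integral>\<xi>. normal_density 0 s 0 \<partial>H)"
    unfolding normal_mixture_def
    by (rule integral_mono[OF integrable_normal_kernel]) (auto intro: normal_density_le_peak s)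
  then show ?thesis by (simp add: prob_space[simplified])
qed

lemma nn_integral_normal_mixture: "(\<integral>\<^sup>+x. ennreal (normal_mixture s H x) \<partial>lborel) = 1"
proof -
  interpret pair_sigma_finite lborel H ..
  have *: "(\<integral>\<^sup>+x. ennreal (normal_density 0 s (x - \<xi>)) \<partial>lborel) = 1" for \<xi>
  proof -
    have "normal_density 0 s (x - \<xi>) = normal_density \<xi> s x" for x
      by (simp add: normal_density_def)
    then show ?thesis
      using prob_space.emeasure_space_1[OF prob_space_normal_density[OF s, of \<xi>]]
      by (simp add: emeasure_density)
  qed
  have "(\<integral>\<^sup>+x. ennreal (normal_mixture s H x) \<partial>lborel)
      = (\<integral>\<^sup>+\<xi>. \<integral>\<^sup>+x. ennreal (normal_density 0 s (x - \<xi>)) \<partial>lborel \<partial>H)"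
    unfolding ennreal_normal_mixture by (rule Fubini'[symmetric]) measurable
  also have "\<dots> = 1" unfolding * by (simp add: emeasure_space_1[simplified])
  finally show ?thesis .
qed

lemma integrable_normal_mixture: "integrable lborel (normal_mixture s H)"
  and integral_normal_mixture: "(\<integral>x. normal_mixture s H x \<partial>lborel) = 1"
proof -
  have "has_bochner_integral lborel (normal_mixture s H) 1"
    by (rule has_bochner_integral_nn_integral)
       (auto simp: nn_integral_normal_mixture measurable_normal_mixture less_imp_le normal_mixture_pos)
  then show "integrable lborel (normal_mixture s H)" "(\<integral>x. normal_mixture s H x \<partial>lborel) = 1"
    by (auto simp: has_bochner_integral_iff)
qed

lemma nn_integral_conv_normal_mixture:
  assumes r: "r > 0"
  shows "(\<integral>\<^sup>+t. ennreal (normal_density 0 r (x - t) * normal_mixture s H t) \<partial>lborel)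
    = ennreal (normal_mixture (sqrt (r\<^sup>2 + s\<^sup>2)) H x)"
proof -
  interpret pair_sigma_finite lborel H ..
  note [measurable] = measurable_normal_mixture
  have rs: "sqrt (r\<^sup>2 + s\<^sup>2) > 0" using r by (simp add: add_pos_nonneg)
  have conv: "(\<integral>\<^sup>+t. ennreal (normal_density 0 r (x - t) * normal_density 0 s (t - \<xi>)) \<partial>lborel)
      = ennreal (normal_density 0 (sqrt (r\<^sup>2 + s\<^sup>2)) (x - \<xi>))" for \<xi>
  proof -
    have "(\<integral>\<^sup>+t. ennreal (normal_density 0 r (x - t) * normal_density 0 s (t - \<xi>)) \<partial>lborel)
       = (\<integral>\<^sup>+t. ennreal (normal_density 0 r ((x - \<xi>) - t) * normal_density 0 s t) \<partial>lborel)"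
      by (subst nn_integral_real_affine[where c = 1 and t = \<xi>]) (auto simp: algebra_simps)
    then show ?thesis
      using fun_cong[OF conv_normal_density_zero_mean[OF r s], of "x - \<xi>"] by simp
  qed
  have "(\<integral>\<^sup>+t. ennreal (normal_density 0 r (x - t) * normal_mixture s H t) \<partial>lborel)
      = (\<integral>\<^sup>+t. \<integral>\<^sup>+\<xi>. ennreal (normal_density 0 r (x - t) * normal_density 0 s (t - \<xi>)) \<partial>H \<partial>lborel)"
    by (simp add: ennreal_mult less_imp_le normal_mixture_pos ennreal_normal_mixture
        nn_integral_cmult)
  also have "\<dots> = (\<integral>\<^sup>+\<xi>. \<integral>\<^sup>+t. ennreal (normal_density 0 r (x - t) * normal_density 0 s (t - \<xi>)) \<partial>lborel \<partial>H)"
    by (rule Fubini'[symmetric]) measurable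
  also have "\<dots> = (\<integral>\<^sup>+\<xi>. ennreal (normal_density 0 (sqrt (r\<^sup>2 + s\<^sup>2)) (x - \<xi>)) \<partial>H)"
    unfolding conv ..
  also have "\<dots> = ennreal (normal_mixture (sqrt (r\<^sup>2 + s\<^sup>2)) H x)"
    unfolding normal_mixture_def
    by (rule nn_integral_eq_integral)
       (auto intro!: integrable_const_bound[where B = "normal_density 0 (sqrt (r\<^sup>2 + s\<^sup>2)) 0"]
          normal_density_le_peak rs)
  finally show ?thesis .
qed

end

lemma has_bochner_integral_conv_normal_mixture:
  assumes H: "real_distribution H" and s: "s > 0" and r: "r > 0"
  shows "has_bochner_integral lborel (\<lambda>t. normal_density 0 r (x - t) * normal_mixture s H t)
           (normal_mixture (sqrt (r\<^sup>2 + s\<^sup>2)) H x)"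
proof -
  note [measurable] = measurable_normal_mixture[OF H s]
  have rs: "sqrt (r\<^sup>2 + s\<^sup>2) > 0" using r by (simp add: add_pos_nonneg)
  show ?thesis
    by (rule has_bochner_integral_nn_integral)
       (auto simp: nn_integral_conv_normal_mixture[OF H s r] less_imp_le normal_mixture_pos[OF H s] normal_mixture_pos[OF H rs])
qed

text \<open>Two mixtures of the same width have an \<open>L\<^sub>2\<close> inner product that is again a mixture, averaged
  once more: the two Gaussian kernels convolve to one of variance \<open>2 * s\<^sup>2\<close>.\<close>

lemma has_bochner_integral_mixture_product:
  assumes H: "real_distribution H" and K: "real_distribution K" and s: "s > 0"
  shows "has_bochner_integral lborel (\<lambda>x. normal_mixture s H x * normal_mixture s K x)
           (\<integral>\<xi>. normal_mixture (sqrt (s\<^sup>2 + s\<^sup>2)) K \<xi> \<partial>H)"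
proof -
  interpret H: real_distribution H by (rule H)
  interpret pair_sigma_finite lborel H ..
  note [measurable] = measurable_normal_mixture[OF H s] measurable_normal_mixture[OF K s]
  define s2 where "s2 = sqrt (s\<^sup>2 + s\<^sup>2)"
  have s2: "s2 > 0" unfolding s2_def using s by (simp add: add_pos_nonneg)
  note [measurable] = measurable_normal_mixture[OF K s2]
  have int: "integrable H (normal_mixture s2 K)"
    by (rule H.integrable_const_bound[where B = "normal_density 0 s2 0"])
       (auto simp: less_imp_le normal_mixture_pos[OF K s2] normal_mixture_le_peak[OF K s2])
  have "(\<integral>\<^sup>+x. ennreal (normal_mixture s H x * normal_mixture s K x) \<partial>lborel)
      = (\<integral>\<^sup>+x. \<integral>\<^sup>+\<xi>. ennreal (normal_density 0 s (\<xi> - x) * normal_mixture s K x) \<partial>H \<partial>lborel)"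
  proof (rule nn_integral_cong)
    fix x
    have "normal_density 0 s (\<xi> - x) = normal_density 0 s (x - \<xi>)" for \<xi>
      using normal_density_uminus[of s "x - \<xi>"] by simp
    then show "ennreal (normal_mixture s H x * normal_mixture s K x)
      = (\<integral>\<^sup>+\<xi>. ennreal (normal_density 0 s (\<xi> - x) * normal_mixture s K x) \<partial>H)"
      by (simp add: ennreal_mult less_imp_le normal_mixture_pos[OF K s] normal_mixture_pos[OF H s]
          ennreal_normal_mixture[OF H s] nn_integral_multc)
  qed
  also have "\<dots> = (\<integral>\<^sup>+\<xi>. \<integral>\<^sup>+x. ennreal (normal_density 0 s (\<xi> - x) * normal_mixture s K x) \<partial>lborel \<partial>H)"
    by (rule Fubini'[symmetric]) measurable
  also have "\<dots> = (\<integral>\<^sup>+\<xi>. ennreal (normal_mixture s2 K \<xi>) \<partial>H)"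
    unfolding nn_integral_conv_normal_mixture[OF K s s] s2_def ..
  also have "\<dots> = ennreal (\<integral>\<xi>. normal_mixture s2 K \<xi> \<partial>H)"
    by (rule nn_integral_eq_integral[OF int]) (simp add: less_imp_le normal_mixture_pos[OF K s2])
  finally have *: "(\<integral>\<^sup>+x. ennreal (normal_mixture s H x * normal_mixture s K x) \<partial>lborel)
      = ennreal (\<integral>\<xi>. normal_mixture s2 K \<xi> \<partial>H)" .
  show ?thesis unfolding s2_def[symmetric]
    by (rule has_bochner_integral_nn_integral[OF _ _ _ *])
       (auto simp: less_imp_le normal_mixture_pos[OF K s] normal_mixture_pos[OF H s] normal_mixture_pos[OF K s2] integral_nonneg_AE)
qed

section \<open>Interpolation between Gaussian widths\<close>

lemma has_bochner_integral_gauss_cos: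
  assumes s: "s > 0"
  shows "has_bochner_integral lborel (\<lambda>t. exp (- s\<^sup>2 * t\<^sup>2) * cos (t * u))
           (2 * pi * normal_density 0 (sqrt (s\<^sup>2 + s\<^sup>2)) u)"
proof -
  define r where "r = sqrt (s\<^sup>2 + s\<^sup>2)"
  have r: "r > 0" and r2: "r\<^sup>2 = s\<^sup>2 + s\<^sup>2" unfolding r_def using s by (simp_all add: add_pos_nonneg)
  define v where "v = u / r"
  have int: "integrable lborel (\<lambda>z. std_normal_density z * cos (v * z))"
    by (rule Bochner_Integration.integrable_bound[OF integrable_normal_density[of 1 0]])
       (auto simp: abs_mult mult_left_le)
  have "(LINT z|std_normal_distribution. cos (v * z)) = Re (char std_normal_distribution v)"
  proof -
    interpret real_distribution std_normal_distribution by (rule real_dist_normal_dist)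
    have "Re (char std_normal_distribution v) = (LINT z|std_normal_distribution. Re (iexp (v * z)))"
      unfolding char_def by (rule integral_Re[symmetric]) (rule integrable_iexp, simp_all)
    then show ?thesis by (simp add: cis_conv_exp[symmetric] del: of_real_mult)
  qed
  also have "\<dots> = exp (- v\<^sup>2 / 2)"
    by (simp add: char_std_normal_distribution)
  also have "(LINT z|std_normal_distribution. cos (v * z)) = (LINT z|lborel. std_normal_density z * cos (v * z))"
    by (subst integral_density) auto
  finally have "has_bochner_integral lborel (\<lambda>z. std_normal_density z * cos (v * z)) (exp (- v\<^sup>2 / 2))"
    using int by (simp add: has_bochner_integral_iff)
  then have "has_bochner_integral lborel (\<lambda>t. std_normal_density (0 + r * t) * cos (v * (0 + r * t)))
      (exp (- v\<^sup>2 / 2) /\<^sub>R \<bar>r\<bar>)"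
    using lborel_has_bochner_integral_real_affine_iff[of r "\<lambda>z. std_normal_density z * cos (v * z)" "exp (- v\<^sup>2 / 2)" 0] r
    by simp
  then have "has_bochner_integral lborel
      (\<lambda>t. sqrt (2 * pi) * (std_normal_density (0 + r * t) * cos (v * (0 + r * t))))
      (sqrt (2 * pi) * (exp (- v\<^sup>2 / 2) /\<^sub>R \<bar>r\<bar>))"
    by (rule has_bochner_integral_mult_right)
  moreover have "sqrt (2 * pi) * (std_normal_density (0 + r * t) * cos (v * (0 + r * t)))
      = exp (- s\<^sup>2 * t\<^sup>2) * cos (t * u)" for t
  proof -
    have a: "v * (0 + r * t) = t * u" using r by (simp add: v_def)
    have b: "- (0 + r * t)\<^sup>2 / 2 = - s\<^sup>2 * t\<^sup>2" by (simp add: power_mult_distrib r2)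
    show ?thesis unfolding std_normal_density_def a b by simp
  qed
  moreover have "sqrt (2 * pi) * (exp (- v\<^sup>2 / 2) /\<^sub>R \<bar>r\<bar>) = 2 * pi * normal_density 0 r u"
  proof -
    have "- v\<^sup>2 / 2 = - (u - 0)\<^sup>2 / (2 * r\<^sup>2)" by (simp add: v_def power_divide)
    moreover have "sqrt (2 * pi * r\<^sup>2) = sqrt (2 * pi) * r" using r by (simp add: real_sqrt_mult)
    ultimately have "normal_density 0 r u = exp (- v\<^sup>2 / 2) / (sqrt (2 * pi) * r)"
      unfolding normal_density_def by (simp only: mult_1_left times_divide_eq_left)
    then have "2 * pi * normal_density 0 r u = 2 * pi * (exp (- v\<^sup>2 / 2) / (sqrt (2 * pi) * r))"
      by (rule arg_cong)
    also have "\<dots> = (2 * pi / sqrt (2 * pi)) * (exp (- v\<^sup>2 / 2) / r)"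
      by (simp only: times_divide_times_eq, simp only: times_divide_eq_right)
    also have "2 * pi / sqrt (2 * pi) = sqrt (2 * pi)" by (rule real_div_sqrt) simp
    finally show ?thesis using r by (simp only: abs_of_pos real_scaleR_def divide_inverse mult.commute)
  qed
  ultimately show ?thesis by (simp add: r_def)
qed

lemma integrable_gauss_weight:
  fixes k :: "real \<Rightarrow> real"
  assumes s: "s > 0" and [measurable]: "k \<in> borel_measurable borel" and k: "\<And>t. \<bar>k t\<bar> \<le> B"
  shows "integrable lborel (\<lambda>t. exp (- s\<^sup>2 * t\<^sup>2) * k t)"
proof -
  have "integrable lborel (\<lambda>t. exp (- s\<^sup>2 * t\<^sup>2) * cos (t * 0))"
    using has_bochner_integral_gauss_cos[OF s, of 0] by (simp add: has_bochner_integral_iff)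
  then have "integrable lborel (\<lambda>t. B * exp (- s\<^sup>2 * t\<^sup>2))" by simp
  then show ?thesis
  proof (rule Bochner_Integration.integrable_bound)
    show "AE t in lborel. norm (exp (- s\<^sup>2 * t\<^sup>2) * k t) \<le> norm (B * exp (- s\<^sup>2 * t\<^sup>2))"
      using order_trans[OF k abs_ge_self] by (auto simp: abs_mult)
  qed simp
qed

lemma integral_gauss_weight_swap:
  fixes b :: "real \<Rightarrow> real \<Rightarrow> real"
  assumes K: "real_distribution K" and s: "s > 0"
    and b[measurable]: "case_prod b \<in> borel_measurable (borel \<Otimes>\<^sub>M borel)"
    and bd: "\<And>t \<xi>. \<bar>b t \<xi>\<bar> \<le> B"
  shows "(\<integral>\<xi>. (\<integral>t. exp (- s\<^sup>2 * t\<^sup>2) * b t \<xi> \<partial>lborel) \<partial>K)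
       = (\<integral>t. exp (- s\<^sup>2 * t\<^sup>2) * (\<integral>\<xi>. b t \<xi> \<partial>K) \<partial>lborel)"
proof -
  interpret K: real_distribution K by (rule K)
  interpret pair_sigma_finite lborel K ..
  have bK: "integrable K (b t)" for t
    by (rule K.integrable_const_bound[where B = B]) (use bd in auto)
  have "integrable (lborel \<Otimes>\<^sub>M K) (\<lambda>(t, \<xi>). exp (- s\<^sup>2 * t\<^sup>2) * b t \<xi>)"
  proof (rule Fubini_integrable)
    have "integrable lborel (\<lambda>t. exp (- s\<^sup>2 * t\<^sup>2) * (\<integral>\<xi>. \<bar>b t \<xi>\<bar> \<partial>K))"
    proof (rule integrable_gauss_weight[OF s])
      fix t
      have "(\<integral>\<xi>. \<bar>b t \<xi>\<bar> \<partial>K) \<le> (\<integral>\<xi>. B \<partial>K)"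
        using bd bK by (intro integral_mono) auto
      then show "\<bar>\<integral>\<xi>. \<bar>b t \<xi>\<bar> \<partial>K\<bar> \<le> B"
        by (simp add: K.prob_space[simplified] abs_of_nonneg)
    qed measurable
    then show "integrable lborel (\<lambda>t. \<integral>\<xi>. norm (case (t, \<xi>) of (t, \<xi>) \<Rightarrow> exp (- s\<^sup>2 * t\<^sup>2) * b t \<xi>) \<partial>K)"
      by (simp add: abs_mult)
  qed (use bK in auto)
  then have "(\<integral>\<xi>. (\<integral>t. exp (- s\<^sup>2 * t\<^sup>2) * b t \<xi> \<partial>lborel) \<partial>K)
       = (\<integral>t. (\<integral>\<xi>. exp (- s\<^sup>2 * t\<^sup>2) * b t \<xi> \<partial>K) \<partial>lborel)"
    by (rule Fubini_integral)
  then show ?thesis by simp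
qed

lemma Re_Im_char:
  assumes "real_distribution K"
  shows "(\<integral>\<xi>. cos (t * \<xi>) \<partial>K) = Re (char K t)" "(\<integral>\<xi>. sin (t * \<xi>) \<partial>K) = Im (char K t)"
    and "integrable K (\<lambda>\<xi>. cos (t * \<xi>))" "integrable K (\<lambda>\<xi>. sin (t * \<xi>))"
    and "\<bar>Re (char K t)\<bar> \<le> 1" "\<bar>Im (char K t)\<bar> \<le> 1"
proof -
  interpret real_distribution K by fact
  have int: "integrable K (\<lambda>\<xi>. iexp (t * \<xi>))" by (rule integrable_iexp) simp_all
  show "(\<integral>\<xi>. cos (t * \<xi>) \<partial>K) = Re (char K t)" "(\<integral>\<xi>. sin (t * \<xi>) \<partial>K) = Im (char K t)"
    unfolding char_def using integral_Re[OF int] integral_Im[OF int]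
    by (simp_all add: cis_conv_exp[symmetric] del: of_real_mult)
  show "integrable K (\<lambda>\<xi>. cos (t * \<xi>))" "integrable K (\<lambda>\<xi>. sin (t * \<xi>))"
    by (auto intro!: integrable_const_bound[where B = 1])
  show "\<bar>Re (char K t)\<bar> \<le> 1" "\<bar>Im (char K t)\<bar> \<le> 1"
    using cmod_char_le_1[of t] abs_Re_le_cmod[of "char K t"] abs_Im_le_cmod[of "char K t"] by linarith+
qed

lemma normal_mixture_eq_char:
  assumes K: "real_distribution K" and s: "s > 0"
  shows "2 * pi * normal_mixture (sqrt (s\<^sup>2 + s\<^sup>2)) K \<xi>
    = (\<integral>t. exp (- s\<^sup>2 * t\<^sup>2) * (cos (t * \<xi>) * Re (char K t) + sin (t * \<xi>) * Im (char K t)) \<partial>lborel)"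
proof -
  have "2 * pi * normal_mixture (sqrt (s\<^sup>2 + s\<^sup>2)) K \<xi>
      = (\<integral>\<eta>. (\<integral>t. exp (- s\<^sup>2 * t\<^sup>2) * cos (t * (\<xi> - \<eta>)) \<partial>lborel) \<partial>K)"
    unfolding normal_mixture_def has_bochner_integral_integral_eq[OF has_bochner_integral_gauss_cos[OF s]]
      integral_mult_right_zero ..
  also have "\<dots> = (\<integral>t. exp (- s\<^sup>2 * t\<^sup>2) * (\<integral>\<eta>. cos (t * (\<xi> - \<eta>)) \<partial>K) \<partial>lborel)"
    by (rule integral_gauss_weight_swap[OF K s, where B = 1]) auto
  finally show ?thesis
    by (simp only: right_diff_distrib cos_diff Re_Im_char[OF K] Bochner_Integration.integral_add
        integral_mult_right_zero integrable_mult_right)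
qed

lemma mixture_product_eq_char:
  assumes H: "real_distribution H" and K: "real_distribution K" and s: "s > 0"
  shows "2 * pi * (\<integral>x. normal_mixture s H x * normal_mixture s K x \<partial>lborel)
    = (\<integral>t. exp (- s\<^sup>2 * t\<^sup>2) * (Re (char H t) * Re (char K t) + Im (char H t) * Im (char K t)) \<partial>lborel)"
proof -
  interpret K: real_distribution K by (rule K)
  have "2 * pi * (\<integral>x. normal_mixture s H x * normal_mixture s K x \<partial>lborel)
      = (\<integral>\<xi>. (\<integral>t. exp (- s\<^sup>2 * t\<^sup>2) * (cos (t * \<xi>) * Re (char K t) + sin (t * \<xi>) * Im (char K t)) \<partial>lborel) \<partial>H)"
    unfolding has_bochner_integral_integral_eq[OF has_bochner_integral_mixture_product[OF H K s]]
      normal_mixture_eq_char[OF K s, symmetric] integral_mult_right_zero ..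
  also have "\<dots> = (\<integral>t. exp (- s\<^sup>2 * t\<^sup>2) * (\<integral>\<xi>. cos (t * \<xi>) * Re (char K t) + sin (t * \<xi>) * Im (char K t) \<partial>H) \<partial>lborel)"
  proof (rule integral_gauss_weight_swap[OF H s, where B = 2])
    fix t \<xi>
    have "\<bar>cos (t * \<xi>)\<bar> * \<bar>Re (char K t)\<bar> \<le> 1 * 1" "\<bar>sin (t * \<xi>)\<bar> * \<bar>Im (char K t)\<bar> \<le> 1 * 1"
      using Re_Im_char(5,6)[OF K, of t] by (intro mult_mono; simp)+
    then show "\<bar>cos (t * \<xi>) * Re (char K t) + sin (t * \<xi>) * Im (char K t)\<bar> \<le> 2"
      unfolding abs_mult[symmetric] by linarith
  qed measurable
  finally show ?thesis
    by (simp only: Re_Im_char[OF H] Bochner_Integration.integral_add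
        integral_mult_left_zero integrable_mult_left)
qed

text \<open>Plancherel's identity for Gaussian mixtures. In this case Fubini suffices, because the
  Gaussian kernel is explicitly a superposition of cosines.\<close>

lemma integral_mixture_diff_sq:
  assumes H: "real_distribution H" and K: "real_distribution K" and s: "s > 0"
  shows "2 * pi * (\<integral>x. (normal_mixture s H x - normal_mixture s K x)\<^sup>2 \<partial>lborel)
    = (\<integral>t. exp (- s\<^sup>2 * t\<^sup>2) * (cmod (char H t - char K t))\<^sup>2 \<partial>lborel)"
    and "integrable lborel (\<lambda>x. (normal_mixture s H x - normal_mixture s K x)\<^sup>2)"
    and "integrable lborel (\<lambda>t. exp (- s\<^sup>2 * t\<^sup>2) * (cmod (char H t - char K t))\<^sup>2)"
proof -
  interpret H: real_distribution H by (rule H)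
  interpret K: real_distribution K by (rule K)
  define P where "P A B = (\<lambda>x. normal_mixture s A x * normal_mixture s B x)" for A B
  define Q where "Q A B = (\<lambda>t. exp (- s\<^sup>2 * t\<^sup>2) * (Re (char A t) * Re (char B t) + Im (char A t) * Im (char B t)))"
    for A B :: "real measure"
  have P: "integrable lborel (P A B)" if "A \<in> {H, K}" "B \<in> {H, K}" for A B
    using has_bochner_integral_mixture_product[of A B s] that H K s
    by (auto simp: P_def has_bochner_integral_iff)
  have Q: "integrable lborel (Q A B)" if "A \<in> {H, K}" "B \<in> {H, K}" for A B
  proof -
    have A: "real_distribution A" and B: "real_distribution B" using that H K by auto
    interpret A: real_distribution A by (rule A)
    interpret B: real_distribution B by (rule B)
    show ?thesis unfolding Q_def
    proof (rule integrable_gauss_weight[OF s, where B = 2])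
      fix t
      have "\<bar>Re (char A t)\<bar> * \<bar>Re (char B t)\<bar> \<le> 1 * 1" "\<bar>Im (char A t)\<bar> * \<bar>Im (char B t)\<bar> \<le> 1 * 1"
        using Re_Im_char(5,6)[OF A, of t] Re_Im_char(5,6)[OF B, of t] by (intro mult_mono; simp)+
      then show "\<bar>Re (char A t) * Re (char B t) + Im (char A t) * Im (char B t)\<bar> \<le> 2"
        unfolding abs_mult[symmetric] by linarith
    qed measurable
  qed
  have PQ: "2 * pi * integral\<^sup>L lborel (P A B) = integral\<^sup>L lborel (Q A B)" if "A \<in> {H, K}" "B \<in> {H, K}" for A B
    unfolding P_def Q_def by (rule mixture_product_eq_char) (use that H K s in auto)
  have p: "(normal_mixture s H x - normal_mixture s K x)\<^sup>2 = P H H x - P H K x - P K H x + P K K x" for x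
    by (simp add: P_def power2_eq_square algebra_simps)
  have expand: "E * ((a - b)\<^sup>2 + (d - e)\<^sup>2)
      = E * (a * a + d * d) - E * (a * b + d * e) - E * (b * a + e * d) + E * (b * b + e * e)"
    for E a b d e :: real
    by (simp add: power2_eq_square algebra_simps)
  have q: "exp (- s\<^sup>2 * t\<^sup>2) * (cmod (char H t - char K t))\<^sup>2 = Q H H t - Q H K t - Q K H t + Q K K t" for t
    unfolding Q_def cmod_power2 minus_complex.sel by (rule expand)
  show "integrable lborel (\<lambda>x. (normal_mixture s H x - normal_mixture s K x)\<^sup>2)"
    unfolding p using P by (intro Bochner_Integration.integrable_add Bochner_Integration.integrable_diff) auto
  show "integrable lborel (\<lambda>t. exp (- s\<^sup>2 * t\<^sup>2) * (cmod (char H t - char K t))\<^sup>2)"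
    unfolding q using Q by (intro Bochner_Integration.integrable_add Bochner_Integration.integrable_diff) auto
  show "2 * pi * (\<integral>x. (normal_mixture s H x - normal_mixture s K x)\<^sup>2 \<partial>lborel)
    = (\<integral>t. exp (- s\<^sup>2 * t\<^sup>2) * (cmod (char H t - char K t))\<^sup>2 \<partial>lborel)"
    unfolding p q by (simp add: P Q PQ[symmetric] algebra_simps)
qed

text \<open>Narrowing the kernel from \<open>s\<close> to \<open>c\<close> multiplies the squared characteristic functions by
  \<open>exp ((s\<^sup>2 - c\<^sup>2) * t\<^sup>2)\<close>. Below a cut-off frequency \<open>T\<close> this factor is paid for; above \<open>T\<close> the
  weight \<open>exp (- c\<^sup>2 * t\<^sup>2)\<close> is small by itself. Equating \<open>exp (- s\<^sup>2 * T\<^sup>2)\<close> with \<open>q\<close> balances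
  the two parts, each of order \<open>q powr (c\<^sup>2 / s\<^sup>2)\<close>.\<close>

lemma narrower_mixture_diff_sq_le:
  assumes H: "real_distribution H" and K: "real_distribution K" and c: "0 < c" "c \<le> s"
    and q: "0 < q" "q \<le> 1"
    and B: "(\<integral>x. (normal_mixture s H x - normal_mixture s K x)\<^sup>2 \<partial>lborel) \<le> B * q"
  shows "(\<integral>x. (normal_mixture c H x - normal_mixture c K x)\<^sup>2 \<partial>lborel)
    \<le> (B + 4 / pi * (\<integral>t. exp (- c\<^sup>2 * t\<^sup>2) \<partial>lborel)) * q powr (c\<^sup>2 / s\<^sup>2)"
proof -
  have s: "s > 0" using c by simp
  interpret H: real_distribution H by (rule H)
  interpret K: real_distribution K by (rule K)
  define T where "T = sqrt (ln (inverse q) / s\<^sup>2)"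
  have "ln q / s\<^sup>2 \<le> 0" using q s by (intro divide_nonpos_pos) auto
  then have T: "T \<ge> 0" "T\<^sup>2 = - ln q / s\<^sup>2" using q by (simp_all add: T_def ln_inverse)
  define W where "W = (\<integral>t. exp (- c\<^sup>2 * t\<^sup>2) \<partial>lborel)"
  define h where "h t = (cmod (char H t - char K t))\<^sup>2" for t
  define w where "w a = (\<lambda>t. exp (- c\<^sup>2 * (t + a)\<^sup>2))" for a
  have h: "0 \<le> h t" "h t \<le> 4" for t
  proof -
    have "cmod (char H t - char K t) \<le> 2"
      using norm_triangle_ineq4[of "char H t" "char K t"] H.cmod_char_le_1[of t] K.cmod_char_le_1[of t] by linarith
    then have "(cmod (char H t - char K t))\<^sup>2 \<le> 2\<^sup>2" by (intro power_mono) auto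
    then show "0 \<le> h t" "h t \<le> 4" by (auto simp: h_def)
  qed
  have w0: "integrable lborel (\<lambda>t. exp (- c\<^sup>2 * t\<^sup>2))"
    using integrable_gauss_weight[OF c(1), of "\<lambda>_. 1" 1] by simp
  have w: "integrable lborel (w a)" "integral\<^sup>L lborel (w a) = W" for a
    using lborel_integrable_real_affine[OF w0, of 1 a] lborel_integral_real_affine[of 1 "\<lambda>t. exp (- c\<^sup>2 * t\<^sup>2)" a]
    by (simp_all add: W_def w_def add.commute)
  have wpos: "0 \<le> w a t" for a t by (simp add: w_def)
  have sc: "T\<^sup>2 * (s\<^sup>2 - c\<^sup>2) = - ln q * (1 - c\<^sup>2 / s\<^sup>2)" and cc: "c\<^sup>2 * T\<^sup>2 = - ln q * (c\<^sup>2 / s\<^sup>2)"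
    using s by (simp_all add: T(2) field_simps)
  have le: "exp (- c\<^sup>2 * t\<^sup>2) * h t \<le> exp (T\<^sup>2 * (s\<^sup>2 - c\<^sup>2)) * (exp (- s\<^sup>2 * t\<^sup>2) * h t)
      + 4 * exp (- c\<^sup>2 * T\<^sup>2) * (w T t + w (- T) t)" for t
  proof (cases "\<bar>t\<bar> \<le> T")
    case True
    then have "t\<^sup>2 \<le> T\<^sup>2" using T(1) by (simp add: abs_le_square_iff[symmetric])
    then have "t\<^sup>2 * (s\<^sup>2 - c\<^sup>2) \<le> T\<^sup>2 * (s\<^sup>2 - c\<^sup>2)"
      using c by (intro mult_right_mono) (auto intro: power_mono)
    then have "exp (- c\<^sup>2 * t\<^sup>2) \<le> exp (T\<^sup>2 * (s\<^sup>2 - c\<^sup>2)) * exp (- s\<^sup>2 * t\<^sup>2)"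
      by (simp add: exp_add[symmetric] algebra_simps)
    then have "exp (- c\<^sup>2 * t\<^sup>2) * h t \<le> exp (T\<^sup>2 * (s\<^sup>2 - c\<^sup>2)) * exp (- s\<^sup>2 * t\<^sup>2) * h t"
      by (rule mult_right_mono) (rule h)
    moreover have "0 \<le> 4 * exp (- c\<^sup>2 * T\<^sup>2) * (w T t + w (- T) t)" by (simp add: w_def)
    ultimately show ?thesis unfolding mult.assoc by linarith
  next
    case False
    have "exp (- c\<^sup>2 * t\<^sup>2) \<le> exp (- c\<^sup>2 * T\<^sup>2) * (w T t + w (- T) t)"
    proof (cases "t \<ge> 0")
      case True
      then have "0 \<le> T * (t - T)" using False T(1) by auto
      then have "T\<^sup>2 + (t - T)\<^sup>2 \<le> t\<^sup>2" by (simp add: power2_eq_square algebra_simps)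
      then have "c\<^sup>2 * (T\<^sup>2 + (t - T)\<^sup>2) \<le> c\<^sup>2 * t\<^sup>2" by (rule mult_left_mono) simp
      then have "exp (- c\<^sup>2 * t\<^sup>2) \<le> exp (- c\<^sup>2 * T\<^sup>2) * w (- T) t"
        unfolding w_def exp_add[symmetric] by (simp add: algebra_simps)
      moreover have "0 \<le> exp (- c\<^sup>2 * T\<^sup>2) * w T t" by (simp add: w_def)
      ultimately show ?thesis unfolding distrib_left by linarith
    next
      case neg: False
      then have "0 \<le> T * (- t - T)" using False T(1) by auto
      then have "T\<^sup>2 + (t + T)\<^sup>2 \<le> t\<^sup>2" by (simp add: power2_eq_square algebra_simps)
      then have "c\<^sup>2 * (T\<^sup>2 + (t + T)\<^sup>2) \<le> c\<^sup>2 * t\<^sup>2" by (rule mult_left_mono) simp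
      then have "exp (- c\<^sup>2 * t\<^sup>2) \<le> exp (- c\<^sup>2 * T\<^sup>2) * w T t"
        unfolding w_def exp_add[symmetric] by (simp add: algebra_simps)
      moreover have "0 \<le> exp (- c\<^sup>2 * T\<^sup>2) * w (- T) t" by (simp add: w_def)
      ultimately show ?thesis unfolding distrib_left by linarith
    qed
    then have "exp (- c\<^sup>2 * t\<^sup>2) * h t \<le> (exp (- c\<^sup>2 * T\<^sup>2) * (w T t + w (- T) t)) * 4"
      by (rule mult_mono) (simp_all add: h add_nonneg_nonneg wpos)
    moreover have "0 \<le> exp (T\<^sup>2 * (s\<^sup>2 - c\<^sup>2)) * (exp (- s\<^sup>2 * t\<^sup>2) * h t)" using h[of t] by simp
    ultimately show ?thesis by linarith
  qed
  have int: "integrable lborel (\<lambda>t. exp (T\<^sup>2 * (s\<^sup>2 - c\<^sup>2)) * (exp (- s\<^sup>2 * t\<^sup>2) * h t))"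
      "integrable lborel (\<lambda>t. 4 * exp (- c\<^sup>2 * T\<^sup>2) * (w T t + w (- T) t))"
    using integral_mixture_diff_sq(3)[OF H K s] w by (simp_all add: h_def del: mult_minus_left)
  have "2 * pi * (\<integral>x. (normal_mixture c H x - normal_mixture c K x)\<^sup>2 \<partial>lborel)
      = (\<integral>t. exp (- c\<^sup>2 * t\<^sup>2) * h t \<partial>lborel)"
    unfolding h_def by (rule integral_mixture_diff_sq(1)[OF H K c(1)])
  also have "\<dots> \<le> (\<integral>t. exp (T\<^sup>2 * (s\<^sup>2 - c\<^sup>2)) * (exp (- s\<^sup>2 * t\<^sup>2) * h t)
      + 4 * exp (- c\<^sup>2 * T\<^sup>2) * (w T t + w (- T) t) \<partial>lborel)"
    using integral_mixture_diff_sq(3)[OF H K c(1)] le int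
    by (intro integral_mono Bochner_Integration.integrable_add) (simp_all add: h_def del: mult_minus_left)
  also have "\<dots> = exp (T\<^sup>2 * (s\<^sup>2 - c\<^sup>2)) * (2 * pi * (\<integral>x. (normal_mixture s H x - normal_mixture s K x)\<^sup>2 \<partial>lborel))
      + 8 * exp (- c\<^sup>2 * T\<^sup>2) * W"
    unfolding integral_mixture_diff_sq(1)[OF H K s] Bochner_Integration.integral_add[OF int]
    using w by (simp add: h_def[symmetric] del: mult_minus_left)
  also have "\<dots> \<le> exp (T\<^sup>2 * (s\<^sup>2 - c\<^sup>2)) * (2 * pi * (B * q)) + 8 * exp (- c\<^sup>2 * T\<^sup>2) * W"
    using B by (intro add_right_mono mult_left_mono) auto
  also have "exp (T\<^sup>2 * (s\<^sup>2 - c\<^sup>2)) * (2 * pi * (B * q)) = 2 * pi * B * (exp (- ln q * (1 - c\<^sup>2 / s\<^sup>2)) * exp (ln q))"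
    using q by (simp add: sc)
  also have "exp (- ln q * (1 - c\<^sup>2 / s\<^sup>2)) * exp (ln q) = q powr (c\<^sup>2 / s\<^sup>2)"
    unfolding exp_add[symmetric] using q by (simp add: powr_def algebra_simps)
  also have "exp (- c\<^sup>2 * T\<^sup>2) = q powr (c\<^sup>2 / s\<^sup>2)"
    using q cc by (simp add: powr_def algebra_simps)
  also have "2 * pi * B * q powr (c\<^sup>2 / s\<^sup>2) + 8 * q powr (c\<^sup>2 / s\<^sup>2) * W
      = 2 * pi * ((B + 4 / pi * W) * q powr (c\<^sup>2 / s\<^sup>2))"
    by (simp add: distrib_left distrib_right)
  finally show ?thesis unfolding W_def by simp
qed

section \<open>Posterior distance and \<open>L\<^sub>1\<close> distance of the priors\<close>

lemma sigma_star_pos: "sigma_star c > 0" and sigma_star_ge_1: "sigma_star c \<ge> 1"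
  and sigma_star_eq: "sigma_star c = sqrt (1\<^sup>2 + c\<^sup>2)"
  by (auto simp: sigma_star_def add_pos_nonneg)

text \<open>The marginal density \<open>f\<close> is the prior density \<open>g\<close> smoothed by the standard normal noise. So
  both the change of the posterior's numerator and that of its normalising constant are bounded by the
  smoothed \<open>\<bar>g\<^sub>H - g\<^sub>K\<bar>\<close>, and smoothing preserves the total mass.\<close>

lemma wTV_le_L1:
  assumes H: "real_distribution H" and K: "real_distribution K" and c: "c > 0"
  shows "wTV c H K \<le> (\<integral>\<theta>. \<bar>g_dens c H \<theta> - g_dens c K \<theta>\<bar> \<partial>lborel)"
proof -
  let ?n = "normal_density 0 1"
  define d where "d \<theta> = \<bar>g_dens c H \<theta> - g_dens c K \<theta>\<bar>" for \<theta>
  define J where "J x = (\<integral>\<theta>. ?n (x - \<theta>) * d \<theta> \<partial>lborel)" for x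
  note mg = measurable_normal_mixture[OF H c, folded g_dens_def] measurable_normal_mixture[OF K c, folded g_dens_def]
  note [measurable] = mg
  have [measurable]: "d \<in> borel_measurable borel" unfolding d_def[abs_def] by measurable
  have g: "has_bochner_integral lborel (\<lambda>\<theta>. ?n (x - \<theta>) * g_dens c A \<theta>) (f_dens c A x)"
    if "A \<in> {H, K}" for A x
    unfolding f_dens_def g_dens_def sigma_star_eq
    by (rule has_bochner_integral_conv_normal_mixture) (use that H K c in auto)
  have gpos: "g_dens c A \<theta> > 0" if "A \<in> {H, K}" for A \<theta>
    unfolding g_dens_def by (rule normal_mixture_pos) (use that H K c in auto)
  have fpos: "f_dens c A \<theta> > 0" if "A \<in> {H, K}" for A \<theta>
    unfolding f_dens_def by (rule normal_mixture_pos) (use that H K sigma_star_pos in auto)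
  have int_d: "integrable lborel d"
    unfolding d_def[abs_def] g_dens_def
    by (intro integrable_abs Bochner_Integration.integrable_diff integrable_normal_mixture H K c)
  have int_nd: "integrable lborel (\<lambda>\<theta>. ?n (x - \<theta>) * d \<theta>)" for x
  proof (rule Bochner_Integration.integrable_bound)
    show "integrable lborel (\<lambda>\<theta>. ?n (x - \<theta>) * g_dens c H \<theta> + ?n (x - \<theta>) * g_dens c K \<theta>)"
      using g by (intro Bochner_Integration.integrable_add) (auto simp: has_bochner_integral_iff)
    have "?n (x - \<theta>) * d \<theta> \<le> ?n (x - \<theta>) * (g_dens c H \<theta> + g_dens c K \<theta>)" for \<theta>
      using gpos[of H \<theta>] gpos[of K \<theta>] by (intro mult_left_mono) (auto simp: d_def)
    then show "AE \<theta> in lborel. norm (?n (x - \<theta>) * d \<theta>)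
        \<le> norm (?n (x - \<theta>) * g_dens c H \<theta> + ?n (x - \<theta>) * g_dens c K \<theta>)"
      using gpos[of H] gpos[of K] by (auto simp: abs_mult d_def distrib_left less_imp_le)
  qed measurable
  have J0: "J x \<ge> 0" for x unfolding J_def by (rule integral_nonneg_AE) (simp add: d_def)
  have fJ: "\<bar>f_dens c H x - f_dens c K x\<bar> \<le> J x" for x
  proof -
    have eq: "f_dens c H x - f_dens c K x = (\<integral>\<theta>. ?n (x - \<theta>) * g_dens c H \<theta> - ?n (x - \<theta>) * g_dens c K \<theta> \<partial>lborel)"
      using g[of H x] g[of K x] by (simp add: has_bochner_integral_iff)
    have "\<bar>f_dens c H x - f_dens c K x\<bar> \<le> (\<integral>\<theta>. \<bar>?n (x - \<theta>) * g_dens c H \<theta> - ?n (x - \<theta>) * g_dens c K \<theta>\<bar> \<partial>lborel)"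
      unfolding eq by (rule integral_abs_bound)
    also have "\<dots> = J x"
      unfolding J_def d_def by (simp add: right_diff_distrib[symmetric] abs_mult del: mult_cancel_right)
    finally show ?thesis .
  qed
  have pointwise: "TV (posterior c H x) (posterior c K x) * f_dens c K x \<le> J x" for x
  proof -
    let ?fH = "f_dens c H x" and ?fK = "f_dens c K x"
    have f: "?fH > 0" "?fK > 0" using fpos by auto
    have "(\<integral>\<theta>. \<bar>posterior c H x \<theta> - posterior c K x \<theta>\<bar> \<partial>lborel) * ?fK
        = (\<integral>\<theta>. \<bar>posterior c H x \<theta> - posterior c K x \<theta>\<bar> * ?fK \<partial>lborel)" by simp
    also have "\<dots> \<le> (\<integral>\<theta>. ?n (x - \<theta>) * d \<theta> + ?n (x - \<theta>) * g_dens c H \<theta> * (\<bar>?fH - ?fK\<bar> / ?fH) \<partial>lborel)"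
    proof (rule integral_mono')
      show "integrable lborel (\<lambda>\<theta>. ?n (x - \<theta>) * d \<theta> + ?n (x - \<theta>) * g_dens c H \<theta> * (\<bar>?fH - ?fK\<bar> / ?fH))"
        using int_nd g[of H x] by (intro Bochner_Integration.integrable_add integrable_mult_left) (auto simp: has_bochner_integral_iff)
    next
      fix \<theta>
      have "\<bar>posterior c H x \<theta> - posterior c K x \<theta>\<bar> * ?fK
         = \<bar>?n (x - \<theta>) * ((g_dens c H \<theta> - g_dens c K \<theta>) - g_dens c H \<theta> * ((?fH - ?fK) / ?fH))\<bar>"
      proof -
        have "(posterior c H x \<theta> - posterior c K x \<theta>) * ?fK
         = ?n (x - \<theta>) * ((g_dens c H \<theta> - g_dens c K \<theta>) - g_dens c H \<theta> * ((?fH - ?fK) / ?fH))"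
          using f unfolding posterior_def by (simp add: field_simps)
        then show ?thesis using f(2) by (metis abs_mult abs_of_pos)
      qed
      also have "\<dots> \<le> ?n (x - \<theta>) * (d \<theta> + g_dens c H \<theta> * (\<bar>?fH - ?fK\<bar> / ?fH))"
      proof -
        have "\<bar>(g_dens c H \<theta> - g_dens c K \<theta>) - g_dens c H \<theta> * ((?fH - ?fK) / ?fH)\<bar>
            \<le> d \<theta> + \<bar>g_dens c H \<theta> * ((?fH - ?fK) / ?fH)\<bar>"
          unfolding d_def by (rule abs_triangle_ineq4)
        also have "\<bar>g_dens c H \<theta> * ((?fH - ?fK) / ?fH)\<bar> = g_dens c H \<theta> * (\<bar>?fH - ?fK\<bar> / ?fH)"
          using f(1) gpos[of H \<theta>] by (simp add: abs_mult)
        finally show ?thesis by (simp add: abs_mult mult_left_mono)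
      qed
      finally show "\<bar>posterior c H x \<theta> - posterior c K x \<theta>\<bar> * ?fK
          \<le> ?n (x - \<theta>) * d \<theta> + ?n (x - \<theta>) * g_dens c H \<theta> * (\<bar>?fH - ?fK\<bar> / ?fH)"
        by (simp add: distrib_left mult.assoc)
      show "0 \<le> ?n (x - \<theta>) * d \<theta> + ?n (x - \<theta>) * g_dens c H \<theta> * (\<bar>?fH - ?fK\<bar> / ?fH)"
        using f gpos[of H \<theta>] by (intro add_nonneg_nonneg mult_nonneg_nonneg) (auto simp: d_def)
    qed
    also have "\<dots> = J x + ?fH * (\<bar>?fH - ?fK\<bar> / ?fH)"
      using int_nd[of x] g[of H x] unfolding J_def
      by (subst Bochner_Integration.integral_add) (auto simp: has_bochner_integral_iff)
    also have "\<dots> \<le> 2 * J x" using fJ[of x] f by simp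
    finally show ?thesis unfolding TV_def by simp
  qed
  have "has_bochner_integral lborel J (integral\<^sup>L lborel d)"
  proof (rule has_bochner_integral_nn_integral)
    show "J \<in> borel_measurable lborel" unfolding J_def[abs_def] by measurable
    show "0 \<le> integral\<^sup>L lborel d" by (rule integral_nonneg_AE) (simp add: d_def)
    have "(\<integral>\<^sup>+x. ennreal (J x) \<partial>lborel) = (\<integral>\<^sup>+x. \<integral>\<^sup>+\<theta>. ennreal (?n (x - \<theta>) * d \<theta>) \<partial>lborel \<partial>lborel)"
      unfolding J_def
      by (intro nn_integral_cong nn_integral_eq_integral[symmetric] int_nd) (auto simp: d_def)
    also have "\<dots> = (\<integral>\<^sup>+\<theta>. \<integral>\<^sup>+x. ennreal (?n (x - \<theta>) * d \<theta>) \<partial>lborel \<partial>lborel)"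
      by (rule lborel_pair.Fubini'[symmetric]) measurable
    also have "\<dots> = (\<integral>\<^sup>+\<theta>. ennreal (d \<theta>) \<partial>lborel)"
    proof (rule nn_integral_cong)
      fix \<theta>
      have "?n (x - \<theta>) = normal_density \<theta> 1 x" for x by (simp add: normal_density_def)
      then show "(\<integral>\<^sup>+x. ennreal (?n (x - \<theta>) * d \<theta>) \<partial>lborel) = ennreal (d \<theta>)"
        using prob_space.emeasure_space_1[OF prob_space_normal_density[of 1 \<theta>]]
        by (simp add: ennreal_mult d_def nn_integral_multc emeasure_density)
    qed
    also have "\<dots> = ennreal (integral\<^sup>L lborel d)"
      by (rule nn_integral_eq_integral[OF int_d]) (simp add: d_def)
    finally show "(\<integral>\<^sup>+x. ennreal (J x) \<partial>lborel) = ennreal (integral\<^sup>L lborel d)" .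
  qed (simp add: J0)
  then have "integrable lborel J" "integral\<^sup>L lborel J = integral\<^sup>L lborel d"
    by (auto simp: has_bochner_integral_iff)
  then show ?thesis
    unfolding wTV_def d_def[symmetric] using pointwise J0 by (metis (no_types, lifting) integral_mono')
qed

lemma wTV_nonneg:
  assumes "real_distribution K"
  shows "wTV c H K \<ge> 0"
proof -
  have "f_dens c K x \<ge> 0" for x
    unfolding f_dens_def using normal_mixture_pos[OF assms sigma_star_pos] by (simp add: less_imp_le)
  then show ?thesis unfolding wTV_def TV_def
    by (auto intro!: integral_nonneg_AE)
qed

text \<open>Outside \<open>[-R, R]\<close>, every centre \<open>\<xi>\<close> is at distance at least \<open>\<bar>x\<bar> / 2\<close> from \<open>x\<close>, so doubling the
  width pays for moving the centre to the origin. Splitting \<open>x\<^sup>2 \<ge> R\<^sup>2 + (\<bar>x\<bar> - R)\<^sup>2\<close> then extracts the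
  small factor and leaves Gaussians that are integrable with total mass independent of \<open>R\<close>.\<close>

lemma normal_mixture_tail_le:
  assumes H: "H \<in> borel_probs {-L..L}" and c: "c > 0" and R: "2 * L \<le> R" "R \<ge> 0" and x: "\<bar>x\<bar> > R"
  shows "normal_mixture c H x
    \<le> 2 * exp (- R\<^sup>2 / (8 * c\<^sup>2)) * (normal_density R (2 * c) x + normal_density (- R) (2 * c) x)"
proof -
  interpret real_distribution H using borel_probsD(1)[OF H] .
  let ?B = "2 * exp (- R\<^sup>2 / (8 * c\<^sup>2)) * (normal_density R (2 * c) x + normal_density (- R) (2 * c) x)"
  have bound: "normal_density 0 c (x - \<xi>) \<le> ?B" if \<xi>: "\<xi> \<in> {-L..L}" for \<xi>
  proof -
    define r where "r = (if x \<ge> 0 then R else - R)"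
    have r: "r\<^sup>2 = R\<^sup>2" "normal_density r (2 * c) x \<le> normal_density R (2 * c) x + normal_density (- R) (2 * c) x"
      by (auto simp: r_def)
    have "- L \<le> \<xi>" "\<xi> \<le> L" using \<xi> by auto
    then have "\<bar>x / 2\<bar> \<le> \<bar>x - \<xi>\<bar>" using x R by arith
    then have "(x / 2)\<^sup>2 \<le> (x - \<xi>)\<^sup>2" by (simp only: abs_le_square_iff)
    then have "x\<^sup>2 \<le> 4 * (x - \<xi>)\<^sup>2" by (simp add: power_divide)
    moreover have "0 \<le> r * (x - r)" using x R by (cases "x \<ge> 0") (auto simp: r_def intro: mult_nonneg_nonneg mult_nonneg_nonpos)
    then have "r\<^sup>2 + (x - r)\<^sup>2 \<le> x\<^sup>2" by (simp add: power2_eq_square algebra_simps)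
    ultimately have "(R\<^sup>2 + (x - r)\<^sup>2) / (8 * c\<^sup>2) \<le> 4 * (x - \<xi>)\<^sup>2 / (8 * c\<^sup>2)"
      unfolding r using c by (intro divide_right_mono) auto
    then have "- ((x - \<xi>) - 0)\<^sup>2 / (2 * c\<^sup>2) \<le> - R\<^sup>2 / (8 * c\<^sup>2) + - (x - r)\<^sup>2 / (2 * (2 * c)\<^sup>2)"
      by (simp add: power_mult_distrib add_divide_distrib)
    then have e: "exp (- ((x - \<xi>) - 0)\<^sup>2 / (2 * c\<^sup>2)) \<le> exp (- R\<^sup>2 / (8 * c\<^sup>2)) * exp (- (x - r)\<^sup>2 / (2 * (2 * c)\<^sup>2))"
      unfolding exp_add[symmetric] by (simp only: exp_le_cancel_iff)
    have sq: "sqrt (2 * pi * (2 * c)\<^sup>2) = 2 * sqrt (2 * pi * c\<^sup>2)"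
    proof -
      have "2 * pi * (2 * c)\<^sup>2 = 2\<^sup>2 * (2 * pi * c\<^sup>2)" by (simp add: power_mult_distrib)
      then show ?thesis by (simp only: real_sqrt_mult[of "2\<^sup>2"] real_sqrt_abs abs_numeral)
    qed
    have "normal_density 0 c (x - \<xi>)
        \<le> 1 / sqrt (2 * pi * c\<^sup>2) * (exp (- R\<^sup>2 / (8 * c\<^sup>2)) * exp (- (x - r)\<^sup>2 / (2 * (2 * c)\<^sup>2)))"
      unfolding normal_density_def by (rule mult_left_mono[OF e]) simp
    also have "\<dots> = 2 * exp (- R\<^sup>2 / (8 * c\<^sup>2)) * normal_density r (2 * c) x"
      unfolding normal_density_def sq by simp
    also have "\<dots> \<le> ?B" by (rule mult_left_mono[OF r(2)]) simp
    finally show ?thesis .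
  qed
  have "AE \<xi> in H. \<xi> \<in> {-L..L}" by (rule AE_borel_probs[OF H]) simp
  then have "AE \<xi> in H. normal_density 0 c (x - \<xi>) \<le> ?B"
    by (rule eventually_mono) (rule bound)
  then have "normal_mixture c H x \<le> (\<integral>\<xi>. ?B \<partial>H)"
    unfolding normal_mixture_def
    by (intro integral_mono_AE integrable_normal_kernel c borel_probsD(1)[OF H]) auto
  then show ?thesis by (simp add: prob_space[simplified])
qed

text \<open>This is Cauchy--Schwarz on \<open>[-R, R]\<close>, linearised with a free parameter \<open>l\<close>, and the tail
  bound outside.\<close>

lemma mixture_L1_le_L2:
  assumes H: "H \<in> borel_probs {-L..L}" and K: "K \<in> borel_probs {-L..L}" and c: "c > 0"
    and R: "2 * L \<le> R" "R > 0" and l: "l > 0"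
  shows "(\<integral>x. \<bar>normal_mixture c H x - normal_mixture c K x\<bar> \<partial>lborel)
    \<le> l / 2 * (\<integral>x. (normal_mixture c H x - normal_mixture c K x)\<^sup>2 \<partial>lborel) + R / l
      + 8 * exp (- R\<^sup>2 / (8 * c\<^sup>2))"
proof -
  note HK = borel_probsD(1)[OF H] borel_probsD(1)[OF K]
  define d where "d x = normal_mixture c H x - normal_mixture c K x" for x
  define E where "E = exp (- R\<^sup>2 / (8 * c\<^sup>2))"
  have int_d2: "integrable lborel (\<lambda>x. (d x)\<^sup>2)"
    unfolding d_def by (rule integral_mixture_diff_sq(2)[OF HK c])
  have ints: "integrable lborel (\<lambda>x. l / 2 * (d x)\<^sup>2)"
    "integrable lborel (\<lambda>x. 1 / (2 * l) * indicator {-R..R} x :: real)"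
    "integrable lborel (\<lambda>x. 4 * E * (normal_density R (2 * c) x + normal_density (- R) (2 * c) x))"
    using int_d2 c R
    by (auto intro!: integrable_normal_density integrable_real_indicator
        Bochner_Integration.integrable_divide Bochner_Integration.integrable_add integrable_mult_right
        simp del: integrable_mult_right_iff)
  have "(\<integral>x. \<bar>d x\<bar> \<partial>lborel) \<le> (\<integral>x. l / 2 * (d x)\<^sup>2 + 1 / (2 * l) * indicator {-R..R} x
      + 4 * E * (normal_density R (2 * c) x + normal_density (- R) (2 * c) x) \<partial>lborel)"
  proof (rule integral_mono')
    fix x
    show "\<bar>d x\<bar> \<le> l / 2 * (d x)\<^sup>2 + 1 / (2 * l) * indicator {-R..R} x
      + 4 * E * (normal_density R (2 * c) x + normal_density (- R) (2 * c) x)"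
    proof (cases "\<bar>x\<bar> \<le> R")
      case True
      have "0 \<le> (l * \<bar>d x\<bar> - 1)\<^sup>2 / (2 * l)" using l by simp
      also have "\<dots> = l / 2 * (d x)\<^sup>2 + 1 / (2 * l) - \<bar>d x\<bar>"
        using l by (simp add: power2_eq_square field_simps)
      finally have "\<bar>d x\<bar> \<le> l / 2 * (d x)\<^sup>2 + 1 / (2 * l)" by simp
      moreover have "0 \<le> 4 * E * (normal_density R (2 * c) x + normal_density (- R) (2 * c) x)"
        by (simp add: E_def)
      moreover have "x \<in> {-R..R}" using True by auto
      ultimately show ?thesis by simp
    next
      case False
      have "\<bar>d x\<bar> \<le> normal_mixture c H x + normal_mixture c K x"
        using normal_mixture_pos[OF HK(1) c, of x] normal_mixture_pos[OF HK(2) c, of x] by (simp add: d_def)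
      also have "\<dots> \<le> 4 * E * (normal_density R (2 * c) x + normal_density (- R) (2 * c) x)"
        using normal_mixture_tail_le[OF H c R(1), of x] normal_mixture_tail_le[OF K c R(1), of x] False R
        by (simp add: E_def)
      also have "\<dots> \<le> l / 2 * (d x)\<^sup>2 + 1 / (2 * l) * indicator {-R..R} x + \<dots>"
        using l by simp
      finally show ?thesis .
    qed
    then show "0 \<le> l / 2 * (d x)\<^sup>2 + 1 / (2 * l) * indicator {-R..R} x
      + 4 * E * (normal_density R (2 * c) x + normal_density (- R) (2 * c) x)" by linarith
  qed (intro Bochner_Integration.integrable_add ints)
  also have "\<dots> = (\<integral>x. l / 2 * (d x)\<^sup>2 \<partial>lborel) + (\<integral>x. 1 / (2 * l) * indicator {-R..R} x \<partial>lborel)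
      + (\<integral>x. 4 * E * (normal_density R (2 * c) x + normal_density (- R) (2 * c) x) \<partial>lborel)"
    by (simp only: Bochner_Integration.integral_add Bochner_Integration.integrable_add ints)
  also have "(\<integral>x. 1 / (2 * l) * indicator {-R..R} x \<partial>lborel) = R / l"
    using R l by simp
  also have "(\<integral>x. 4 * E * (normal_density R (2 * c) x + normal_density (- R) (2 * c) x) \<partial>lborel) = 8 * E"
    using c by (simp add: integral_normal_density integrable_normal_density)
  finally show ?thesis unfolding d_def E_def by simp
qed

section \<open>A finite net for the likelihoods\<close>

lemma exp_series: "(\<Sum>k. z ^ k /\<^sub>R fact k) = exp (z :: real)"
  by (rule sums_unique[OF exp_converges, symmetric])

text \<open>The Lagrange remainder contains \<open>Y ^ N / fact N\<close>, which is \<open>exp (- N)\<close> times the term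
  \<open>(exp 1 * Y) ^ N / fact N\<close> of the series of \<open>exp (exp 1 * Y)\<close>, and \<open>exp 1 \<le> 3\<close>.\<close>

lemma exp_Taylor_remainder_le:
  fixes y Y :: real
  assumes "\<bar>y\<bar> \<le> Y"
  shows "\<bar>exp y - (\<Sum>k<N. y ^ k / fact k)\<bar> \<le> exp (4 * Y - real N)"
proof -
  have Y: "Y \<ge> 0" using assms by simp
  obtain t where t: "\<bar>t\<bar> \<le> \<bar>y\<bar>" "exp y = (\<Sum>k<N. y ^ k / fact k) + exp t / fact N * y ^ N"
    using Maclaurin_exp_le by blast
  have "(\<Sum>k\<in>{N}. (exp 1 * Y) ^ k /\<^sub>R fact k) \<le> (\<Sum>k. (exp 1 * Y) ^ k /\<^sub>R fact k)"
    using Y by (intro sum_le_suminf sums_summable[OF exp_converges]) auto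
  then have "(exp 1 * Y) ^ N / fact N \<le> exp (exp 1 * Y)"
    unfolding exp_series by (simp add: divide_inverse mult.commute)
  also have "\<dots> \<le> exp (3 * Y)"
    using Y exp_le by (simp add: mult_right_mono)
  finally have "exp (real N) * (Y ^ N / fact N) \<le> exp (3 * Y)"
    by (simp add: power_mult_distrib exp_of_nat_mult[symmetric])
  then have Yn: "Y ^ N / fact N \<le> exp (3 * Y) / exp (real N)"
    by (subst pos_le_divide_eq) (simp_all add: mult.commute)
  have "\<bar>exp y - (\<Sum>k<N. y ^ k / fact k)\<bar> = exp t * (\<bar>y\<bar> ^ N / fact N)"
    using t(2) by (simp add: abs_mult power_abs)
  also have "\<dots> \<le> exp Y * (Y ^ N / fact N)"
    using t(1) assms by (intro mult_mono divide_right_mono power_mono) auto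
  also have "\<dots> \<le> exp Y * (exp (3 * Y) / exp (real N))"
    by (rule mult_left_mono[OF Yn]) simp
  also have "\<dots> = exp (4 * Y - real N)"
    by (simp add: exp_diff exp_add[symmetric])
  finally show ?thesis .
qed

text \<open>Expanding the square in the kernel of width \<open>s\<close>, with \<open>a = 1 / s\<^sup>2\<close>, gives the factor
  \<open>exp (a * x * \<xi>) * exp (- a * \<xi>\<^sup>2 / 2)\<close>. So up to factorials these are the Taylor coefficients, in the
  variable \<open>a * x\<close>, of the ratio of the mixture to the central Gaussian.\<close>

definition tilted_moment :: "real \<Rightarrow> real measure \<Rightarrow> nat \<Rightarrow> real" where
  "tilted_moment a H k = (\<integral>\<xi>. \<xi> ^ k * exp (- a * \<xi>\<^sup>2 / 2) \<partial>H)"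

context
  fixes s L a :: real and H :: "real measure"
  assumes s: "s > 0" and L: "L > 0" and a_eq: "a = 1 / s\<^sup>2" and H: "H \<in> borel_probs {-L..L}"
begin

interpretation real_distribution H using borel_probsD(1)[OF H] .

lemma a_pos: "a > 0" using s by (simp add: a_eq)

lemma AE_abs_le: "AE \<xi> in H. \<bar>\<xi>\<bar> \<le> L"
proof -
  have "{-L..L} = {\<xi>. \<bar>\<xi>\<bar> \<le> L}" by auto
  then show ?thesis using AE_borel_probs[OF H] by simp
qed

lemma integrable_tilted:
  assumes [measurable]: "h \<in> borel_measurable borel" and "\<And>\<xi>. \<bar>\<xi>\<bar> \<le> L \<Longrightarrow> \<bar>h \<xi>\<bar> \<le> B"
  shows "integrable H (\<lambda>\<xi>. h \<xi> * exp (- a * \<xi>\<^sup>2 / 2))"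
proof (rule integrable_const_bound[where B = B])
  have "\<bar>h \<xi>\<bar> * exp (- a * \<xi>\<^sup>2 / 2) \<le> B" if "\<bar>\<xi>\<bar> \<le> L" for \<xi>
  proof -
    have "\<bar>h \<xi>\<bar> * exp (- a * \<xi>\<^sup>2 / 2) \<le> \<bar>h \<xi>\<bar> * 1"
      using a_pos by (intro mult_left_mono) auto
    then show ?thesis using assms(2)[OF that] by simp
  qed
  then show "AE \<xi> in H. norm (h \<xi> * exp (- a * \<xi>\<^sup>2 / 2)) \<le> B"
    using AE_abs_le by (auto elim!: eventually_mono simp: abs_mult)
qed measurable

lemma abs_tilted_moment_le: "\<bar>tilted_moment a H k\<bar> \<le> L ^ k"
proof -
  have "\<bar>tilted_moment a H k\<bar> \<le> (\<integral>\<xi>. \<bar>\<xi> ^ k * exp (- a * \<xi>\<^sup>2 / 2)\<bar> \<partial>H)"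
    unfolding tilted_moment_def by (rule integral_abs_bound)
  also have "\<dots> \<le> (\<integral>\<xi>. L ^ k \<partial>H)"
  proof (rule integral_mono_AE)
    show "integrable H (\<lambda>\<xi>. \<bar>\<xi> ^ k * exp (- a * \<xi>\<^sup>2 / 2)\<bar>)"
      by (intro integrable_abs integrable_tilted[where B = "L ^ k"]) (auto simp: power_abs intro: power_mono)
    have "\<bar>\<xi>\<bar> ^ k * exp (- a * \<xi>\<^sup>2 / 2) \<le> L ^ k * 1" if "\<bar>\<xi>\<bar> \<le> L" for \<xi>
      using that a_pos L by (intro mult_mono power_mono) auto
    then show "AE \<xi> in H. \<bar>\<xi> ^ k * exp (- a * \<xi>\<^sup>2 / 2)\<bar> \<le> L ^ k"
      using AE_abs_le by (auto elim!: eventually_mono simp: abs_mult power_abs)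
  qed simp
  finally show ?thesis by (simp add: prob_space[simplified])
qed

lemma normal_mixture_eq_tilted:
  "normal_mixture s H x = normal_density 0 s x * (\<integral>\<xi>. exp (a * x * \<xi>) * exp (- a * \<xi>\<^sup>2 / 2) \<partial>H)"
proof -
  have "normal_density 0 s (x - \<xi>) = normal_density 0 s x * (exp (a * x * \<xi>) * exp (- a * \<xi>\<^sup>2 / 2))" for \<xi>
  proof -
    have "- ((x - \<xi>) - 0)\<^sup>2 / (2 * s\<^sup>2) = - (x - 0)\<^sup>2 / (2 * s\<^sup>2) + (a * x * \<xi> + - a * \<xi>\<^sup>2 / 2)"
      using s by (simp add: a_eq power2_eq_square field_simps)
    then show ?thesis unfolding normal_density_def exp_add[symmetric] mult.assoc by (simp only:)
  qed
  then show ?thesis unfolding normal_mixture_def by simp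
qed

lemma integrable_tilted_exp: "integrable H (\<lambda>\<xi>. exp (a * x * \<xi>) * exp (- a * \<xi>\<^sup>2 / 2))"
proof (rule integrable_tilted[where B = "exp (a * \<bar>x\<bar> * L)"])
  fix \<xi> assume "\<bar>\<xi>\<bar> \<le> L"
  then have "a * (x * \<xi>) \<le> a * (\<bar>x\<bar> * L)"
    using a_pos by (intro mult_left_mono) (auto intro: order_trans[OF abs_ge_self] simp: abs_mult mult_left_mono)
  then show "\<bar>exp (a * x * \<xi>)\<bar> \<le> exp (a * \<bar>x\<bar> * L)" by (simp add: mult.assoc)
qed measurable

lemma tilted_integral_ge:
  assumes x: "\<bar>x\<bar> \<le> R"
  shows "exp (- (a * R * L) - a * L\<^sup>2 / 2) \<le> (\<integral>\<xi>. exp (a * x * \<xi>) * exp (- a * \<xi>\<^sup>2 / 2) \<partial>H)"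
proof -
  have "exp (- (a * R * L) - a * L\<^sup>2 / 2) \<le> exp (a * x * \<xi>) * exp (- a * \<xi>\<^sup>2 / 2)" if "\<bar>\<xi>\<bar> \<le> L" for \<xi>
  proof -
    have "\<bar>x * \<xi>\<bar> \<le> R * L" unfolding abs_mult using that x by (intro mult_mono) auto
    then have "a * (- (R * L)) \<le> a * (x * \<xi>)" using a_pos by (intro mult_left_mono) auto
    moreover have "\<xi>\<^sup>2 \<le> L\<^sup>2" using that by (simp add: abs_le_square_iff[symmetric])
    then have "a * \<xi>\<^sup>2 \<le> a * L\<^sup>2" using a_pos by (intro mult_left_mono) auto
    ultimately show ?thesis unfolding exp_add[symmetric] by (simp add: mult.assoc)
  qed
  then have "(\<integral>\<xi>. exp (- (a * R * L) - a * L\<^sup>2 / 2) \<partial>H) \<le> (\<integral>\<xi>. exp (a * x * \<xi>) * exp (- a * \<xi>\<^sup>2 / 2) \<partial>H)"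
    using AE_abs_le by (intro integral_mono_AE integrable_tilted_exp) (auto elim!: eventually_mono)
  then show ?thesis by (simp add: prob_space[simplified])
qed

lemma tilted_integral_Taylor:
  assumes x: "\<bar>x\<bar> \<le> R"
  shows "\<bar>(\<integral>\<xi>. exp (a * x * \<xi>) * exp (- a * \<xi>\<^sup>2 / 2) \<partial>H) - (\<Sum>k<N. (a * x) ^ k / fact k * tilted_moment a H k)\<bar>
    \<le> exp (4 * (a * R * L) - real N)"
proof -
  let ?E = "\<lambda>\<xi>. exp (- a * \<xi>\<^sup>2 / 2)"
  have int: "integrable H (\<lambda>\<xi>. \<xi> ^ k * ?E \<xi>)" for k
    by (rule integrable_tilted[where B = "L ^ k"]) (auto simp: power_abs intro: power_mono)
  have "(\<Sum>k<N. (a * x) ^ k / fact k * tilted_moment a H k)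
      = (\<integral>\<xi>. (\<Sum>k<N. (a * x) ^ k / fact k * (\<xi> ^ k * ?E \<xi>)) \<partial>H)"
    unfolding tilted_moment_def
    by (subst Bochner_Integration.integral_sum) (simp_all only: int integrable_mult_right integral_mult_right_zero)
  then have eq: "(\<integral>\<xi>. exp (a * x * \<xi>) * ?E \<xi> \<partial>H) - (\<Sum>k<N. (a * x) ^ k / fact k * tilted_moment a H k)
      = (\<integral>\<xi>. exp (a * x * \<xi>) * ?E \<xi> - (\<Sum>k<N. (a * x) ^ k / fact k * (\<xi> ^ k * ?E \<xi>)) \<partial>H)"
    by (simp only:) (rule Bochner_Integration.integral_diff[symmetric];
        intro integrable_tilted_exp Bochner_Integration.integrable_sum integrable_mult_right int)
  have "\<bar>exp (a * x * \<xi>) * ?E \<xi> - (\<Sum>k<N. (a * x) ^ k / fact k * (\<xi> ^ k * ?E \<xi>))\<bar>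
      \<le> exp (4 * (a * R * L) - real N)" if "\<bar>\<xi>\<bar> \<le> L" for \<xi>
  proof -
    have "(\<Sum>k<N. (a * x) ^ k / fact k * (\<xi> ^ k * ?E \<xi>)) = (\<Sum>k<N. (a * x * \<xi>) ^ k / fact k) * ?E \<xi>"
      unfolding sum_distrib_right
      by (intro sum.cong refl) (simp only: power_mult_distrib times_divide_eq_left times_divide_eq_right mult_ac)
    then have "\<bar>exp (a * x * \<xi>) * ?E \<xi> - (\<Sum>k<N. (a * x) ^ k / fact k * (\<xi> ^ k * ?E \<xi>))\<bar>
       = \<bar>exp (a * x * \<xi>) - (\<Sum>k<N. (a * x * \<xi>) ^ k / fact k)\<bar> * ?E \<xi>"
      by (simp add: left_diff_distrib[symmetric] abs_mult)
    also have "\<dots> \<le> exp (4 * (a * R * L) - real N) * 1"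
    proof (rule mult_mono)
      have "\<bar>x * \<xi>\<bar> \<le> R * L" unfolding abs_mult using that x by (intro mult_mono) auto
      then have "\<bar>a * x * \<xi>\<bar> \<le> a * R * L" using a_pos by (simp add: abs_mult mult.assoc)
      then show "\<bar>exp (a * x * \<xi>) - (\<Sum>k<N. (a * x * \<xi>) ^ k / fact k)\<bar> \<le> exp (4 * (a * R * L) - real N)"
        by (rule exp_Taylor_remainder_le)
    qed (use a_pos in auto)
    finally show ?thesis by simp
  qed
  then have AE: "AE \<xi> in H. \<bar>exp (a * x * \<xi>) * ?E \<xi> - (\<Sum>k<N. (a * x) ^ k / fact k * (\<xi> ^ k * ?E \<xi>))\<bar>
      \<le> exp (4 * (a * R * L) - real N)"
    using AE_abs_le by (auto elim!: eventually_mono)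
  have "\<bar>\<integral>\<xi>. exp (a * x * \<xi>) * ?E \<xi> - (\<Sum>k<N. (a * x) ^ k / fact k * (\<xi> ^ k * ?E \<xi>)) \<partial>H\<bar>
      \<le> (\<integral>\<xi>. \<bar>exp (a * x * \<xi>) * ?E \<xi> - (\<Sum>k<N. (a * x) ^ k / fact k * (\<xi> ^ k * ?E \<xi>))\<bar> \<partial>H)"
    by (rule integral_abs_bound)
  also have "\<dots> \<le> (\<integral>\<xi>. exp (4 * (a * R * L) - real N) \<partial>H)"
    by (rule integral_mono_AE[OF _ _ AE])
       (intro integrable_abs Bochner_Integration.integrable_diff integrable_tilted_exp
          Bochner_Integration.integrable_sum integrable_mult_right int, simp)
  finally show ?thesis unfolding eq by (simp add: prob_space[simplified])
qed

end

text \<open>On \<open>[-R, R]\<close>, the likelihood ratio to the central Gaussian is an entire function of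
  exponential type in \<open>x\<close>, whose Taylor coefficients are multiples of the tilted moments of the mixing measure.
  Thus \<open>N\<close> moments, each rounded to a grid, determine \<open>f\<^sub>H\<close> up to a factor \<open>1 + \<epsilon>\<close>. The grid
  width and \<open>N\<close> have to beat the smallest value of that ratio, which is only exponentially small in
  \<open>R\<close>. The representatives are chosen within the given set \<open>S\<close>, so they inherit its
  defining property.\<close>

lemma finite_likelihood_net:
  fixes s L R \<epsilon> :: real
  assumes s: "s > 0" and L: "L > 0" and R: "R \<ge> 0" and eps: "0 < \<epsilon>" "\<epsilon> \<le> 1"
    and S: "S \<subseteq> borel_probs {-L..L}"
    and Y_def: "Y = R * L / s\<^sup>2" and b_def: "b = L\<^sup>2 / (2 * s\<^sup>2)"
    and N: "real N \<ge> 5 * Y + b + ln (4 / \<epsilon>)"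
  obtains T where "finite T" "T \<subseteq> S" "real (card T) \<le> (8 / \<epsilon> * exp (2 * Y + b)) ^ N"
    and "\<And>H. H \<in> S \<Longrightarrow> \<exists>K\<in>T. \<forall>x. \<bar>x\<bar> \<le> R \<longrightarrow> normal_mixture s H x \<le> (1 + \<epsilon>) * normal_mixture s K x"
proof -
  define a where "a = 1 / s\<^sup>2"
  have a: "a > 0" using s by (simp add: a_def)
  have Y: "Y = a * R * L" "Y \<ge> 0" and b: "b = a * L\<^sup>2 / 2" "b \<ge> 0"
    using R L s by (simp_all add: Y_def b_def a_def)
  \<comment> \<open>Rounding costs at most \<open>\<eta> * exp Y\<close> after summing the series. This should be half of the
    allowance, which is \<open>\<epsilon>\<close> times the lower bound \<open>exp (- Y - b)\<close> of the ratio to the central Gaussian.\<close>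
  define \<eta> where "\<eta> = \<epsilon> / 2 * exp (- 2 * Y - b)"
  have \<eta>: "\<eta> > 0" using eps by (simp add: \<eta>_def)
  have "\<eta> \<le> 1 / 2 * 1" unfolding \<eta>_def using eps Y b by (intro mult_mono) auto
  then have \<eta>2: "\<eta> \<le> 1 / 2" by simp
  define cell where "cell H = (\<lambda>k\<in>{..<N}. \<lfloor>tilted_moment a H k / (\<eta> * L ^ k)\<rfloor>)" for H
  define m where "m = \<lceil>1 / \<eta>\<rceil>"
  let ?C = "PiE {..<N} (\<lambda>_. {- m..m})"
  have finC: "finite ?C" by (intro finite_PiE) auto
  have cellC: "cell ` S \<subseteq> ?C"
  proof (intro image_subsetI)
    fix H assume "H \<in> S"
    then have H: "H \<in> borel_probs {-L..L}" using S by auto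
    have "\<lfloor>tilted_moment a H k / (\<eta> * L ^ k)\<rfloor> \<in> {- m..m}" for k
    proof -
      have "\<bar>tilted_moment a H k / (\<eta> * L ^ k)\<bar> = \<bar>tilted_moment a H k\<bar> / (\<eta> * L ^ k)"
        using \<eta> L by simp
      also have "\<dots> \<le> L ^ k / (\<eta> * L ^ k)"
        using abs_tilted_moment_le[OF s L a_def H, of k] \<eta> L by (intro divide_right_mono) auto
      also have "\<dots> = 1 / \<eta>" using L by simp
      also have "\<dots> \<le> of_int m" by (simp add: m_def)
      finally have "- of_int m \<le> tilted_moment a H k / (\<eta> * L ^ k)" "tilted_moment a H k / (\<eta> * L ^ k) \<le> of_int m"
        by linarith+
      then show ?thesis by (simp add: le_floor_iff floor_le_iff)
    qed
    then show "cell H \<in> ?C" by (auto simp: cell_def)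
  qed
  define T where "T = inv_into S cell ` cell ` S"
  show ?thesis
  proof
    show "finite T" unfolding T_def by (intro finite_imageI finite_subset[OF cellC finC])
    show "T \<subseteq> S" unfolding T_def by (auto intro: inv_into_into)
    have "card T \<le> card (cell ` S)" unfolding T_def
      by (intro card_image_le finite_subset[OF cellC finC])
    also have "\<dots> \<le> card ?C" by (rule card_mono[OF finC cellC])
    also have "\<dots> = nat (2 * m + 1) ^ N" by (simp add: card_PiE algebra_simps)
    finally have "real (card T) \<le> real (nat (2 * m + 1) ^ N)" by (rule of_nat_mono)
    also have "\<dots> = real (nat (2 * m + 1)) ^ N" by simp
    also have "\<dots> \<le> (8 / \<epsilon> * exp (2 * Y + b)) ^ N"
    proof (rule power_mono)
      have "0 \<le> 1 / \<eta>" using \<eta> by simp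
      then have "0 \<le> m" unfolding m_def by linarith
      then have "real (nat (2 * m + 1)) = 2 * of_int m + 1" by simp
      also have "\<dots> \<le> 2 * (1 / \<eta> + 1) + 1" 
        unfolding m_def
        by (intro add_right_mono mult_left_mono of_int_ceiling_le_add_one) simp
      also have "\<dots> \<le> 4 / \<eta>" proof -
        have "2 \<le> 1 / \<eta>" using \<eta> \<eta>2 by (simp add: field_simps)
        then show ?thesis by simp
      qed
      also have "\<dots> = 8 / \<epsilon> * exp (2 * Y + b)"
        unfolding \<eta>_def using eps by (simp add: exp_minus field_simps exp_diff exp_add)
      finally show "real (nat (2 * m + 1)) \<le> 8 / \<epsilon> * exp (2 * Y + b)" .
    qed simp
    finally show "real (card T) \<le> (8 / \<epsilon> * exp (2 * Y + b)) ^ N" .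
    fix H assume HS: "H \<in> S"
    define K where "K = inv_into S cell (cell H)"
    have KT: "K \<in> T" and KS: "K \<in> S" using HS by (auto simp: K_def T_def intro: inv_into_into)
    have cell_eq: "cell K = cell H" unfolding K_def using HS by (intro f_inv_into_f) auto
    have H: "H \<in> borel_probs {-L..L}" and K: "K \<in> borel_probs {-L..L}" using HS KS S by auto
    have mom: "\<bar>tilted_moment a H k - tilted_moment a K k\<bar> \<le> \<eta> * L ^ k" if "k < N" for k
    proof -
      have "\<lfloor>tilted_moment a K k / (\<eta> * L ^ k)\<rfloor> = \<lfloor>tilted_moment a H k / (\<eta> * L ^ k)\<rfloor>"
        using fun_cong[OF cell_eq, of k] that by (simp add: cell_def)
      then have "\<bar>tilted_moment a H k / (\<eta> * L ^ k) - tilted_moment a K k / (\<eta> * L ^ k)\<bar> \<le> 1"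
        by linarith
      then have "\<bar>tilted_moment a H k - tilted_moment a K k\<bar> / (\<eta> * L ^ k) \<le> 1"
        using \<eta> L by (simp add: diff_divide_distrib[symmetric])
      then show ?thesis using \<eta> L by (simp add: divide_le_eq)
    qed
    have "normal_mixture s H x \<le> (1 + \<epsilon>) * normal_mixture s K x" if x: "\<bar>x\<bar> \<le> R" for x
    proof -
      define w where "w A = (\<integral>\<xi>. exp (a * x * \<xi>) * exp (- a * \<xi>\<^sup>2 / 2) \<partial>A)" for A
      define p where "p A = (\<Sum>k<N. (a * x) ^ k / fact k * tilted_moment a A k)" for A
      have w: "\<bar>w A - p A\<bar> \<le> exp (4 * Y - real N)" if "A \<in> {H, K}" for A
        unfolding w_def p_def Y by (rule tilted_integral_Taylor[OF s L a_def _ x]) (use that H K in auto)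
      have "\<bar>p H - p K\<bar> \<le> (\<Sum>k<N. \<bar>(a * x) ^ k / fact k * tilted_moment a H k - (a * x) ^ k / fact k * tilted_moment a K k\<bar>)"
        unfolding p_def sum_subtractf[symmetric] by (rule sum_abs)
      also have "\<dots> \<le> (\<Sum>k<N. \<eta> * (Y ^ k /\<^sub>R fact k))"
      proof (rule sum_mono)
        fix k assume k: "k \<in> {..<N}"
        have "\<bar>(a * x) ^ k / fact k * tilted_moment a H k - (a * x) ^ k / fact k * tilted_moment a K k\<bar>
            = (a * \<bar>x\<bar>) ^ k / fact k * \<bar>tilted_moment a H k - tilted_moment a K k\<bar>"
          using a by (simp add: right_diff_distrib[symmetric] abs_mult power_abs del: times_divide_eq_left)
        also have "\<dots> \<le> (a * R) ^ k / fact k * (\<eta> * L ^ k)"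
          using mom[of k] k x a R by (intro mult_mono divide_right_mono power_mono) auto
        also have "\<dots> = \<eta> * (Y ^ k /\<^sub>R fact k)"
          by (simp add: Y power_mult_distrib divide_inverse)
        finally show "\<bar>(a * x) ^ k / fact k * tilted_moment a H k - (a * x) ^ k / fact k * tilted_moment a K k\<bar> \<le> \<eta> * (Y ^ k /\<^sub>R fact k)" .
      qed
      also have "\<dots> = \<eta> * (\<Sum>k<N. Y ^ k /\<^sub>R fact k)" by (rule sum_distrib_left[symmetric])
      also have "\<dots> \<le> \<eta> * (\<Sum>k. Y ^ k /\<^sub>R fact k)"
        using \<eta> Y(2) by (intro mult_left_mono sum_le_suminf sums_summable[OF exp_converges]) auto
      also have "\<dots> = \<eta> * exp Y" by (simp only: exp_series)
      also have "\<dots> = \<epsilon> / 2 * exp (- Y - b)" by (simp add: \<eta>_def exp_add[symmetric] mult.assoc)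
      finally have p: "\<bar>p H - p K\<bar> \<le> \<epsilon> / 2 * exp (- Y - b)" .
      have "exp (4 * Y - real N) \<le> exp (- Y - b - ln (4 / \<epsilon>))" using N by simp
      also have "\<dots> = \<epsilon> / 4 * exp (- Y - b)" using eps by (simp add: exp_diff mult.commute)
      finally have N': "exp (4 * Y - real N) \<le> \<epsilon> / 4 * exp (- Y - b)" .
      have lower: "exp (- Y - b) \<le> w K"
        unfolding w_def Y b by (rule tilted_integral_ge[OF s L a_def K x])
      have "w H - w K \<le> \<epsilon> * exp (- Y - b)"
        using w[of H, simplified] w[of K, simplified] p N' unfolding abs_le_iff by linarith
      also have "\<dots> \<le> \<epsilon> * w K" using lower eps by (intro mult_left_mono) auto
      finally have "w H \<le> (1 + \<epsilon>) * w K" by (simp add: algebra_simps)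
      then have "normal_density 0 s x * w H \<le> normal_density 0 s x * ((1 + \<epsilon>) * w K)"
        by (rule mult_left_mono) simp
      then show ?thesis
        unfolding normal_mixture_eq_tilted[OF s L a_def H] normal_mixture_eq_tilted[OF s L a_def K] w_def
        by (simp only: mult_ac)
    qed
    then show "\<exists>K\<in>T. \<forall>x. \<bar>x\<bar> \<le> R \<longrightarrow> normal_mixture s H x \<le> (1 + \<epsilon>) * normal_mixture s K x"
      using KT by blast
  qed
qed

section \<open>The optimality condition of the Kullback--Leibler projection\<close>

text \<open>Tossing a coin of bias \<open>t\<close> and then drawing from one of the two measures realises the convex
  combination as a measure on the line.\<close>

lemma convex_borel_probs:
  assumes H0: "H0 \<in> borel_probs A" and H1: "H1 \<in> borel_probs A" and A: "A \<in> sets borel"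
    and t: "0 \<le> t" "t \<le> 1"
  obtains H where "H \<in> borel_probs A"
    and "\<And>s x. s > 0 \<Longrightarrow> normal_mixture s H x = (1 - t) * normal_mixture s H0 x + t * normal_mixture s H1 x"
proof
  define N where "N b = (if b then H1 else H0)" for b
  define H where "H = measure_pmf (bernoulli_pmf t) \<bind> N"
  have N: "real_distribution (N b)" "measure (N b) A = 1" for b
    using borel_probsD[OF H0] borel_probsD[OF H1] by (auto simp: N_def)
  have N1: "prob_space (N b)" "sets (N b) = sets borel" for b
    using N(1)[of b] by (auto simp: real_distribution_def real_distribution.events_eq_borel)
  have NM: "N \<in> measurable (measure_pmf (bernoulli_pmf t)) (subprob_algebra borel)"
    using N1 by (auto simp: space_subprob_algebra intro: prob_space_imp_subprob_space)
  have "prob_space H" unfolding H_def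
    by (rule prob_space.prob_space_bind[OF prob_space_measure_pmf _ NM]) (auto simp: N1)
  moreover have sH: "sets H = sets borel" unfolding H_def by (rule sets_bind) (auto simp: N1)
  ultimately have rd: "real_distribution H"
    by (auto simp: real_distribution_def real_distribution_axioms_def)
  have "emeasure H A = (\<integral>\<^sup>+b. emeasure (N b) A \<partial>measure_pmf (bernoulli_pmf t))"
    unfolding H_def using A by (intro emeasure_bind[OF _ NM]) auto
  also have "\<dots> = (\<integral>\<^sup>+b. 1 \<partial>measure_pmf (bernoulli_pmf t))"
    using N N1 by (intro nn_integral_cong)
      (auto simp: finite_measure.emeasure_eq_measure prob_space.finite_measure)
  also have "\<dots> = 1" by (simp add: measure_pmf.emeasure_space_1[simplified])
  finally show "H \<in> borel_probs A" using rd by (simp add: borel_probs_def measure_def)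
  fix s x :: real assume s: "s > 0"
  have pos: "normal_mixture s (N b) x > 0" for b by (rule normal_mixture_pos[OF N(1) s])
  have "ennreal (normal_mixture s H x) = (\<integral>\<^sup>+\<xi>. ennreal (normal_density 0 s (x - \<xi>)) \<partial>H)"
    by (rule ennreal_normal_mixture[OF rd s])
  also have "\<dots> = (\<integral>\<^sup>+b. \<integral>\<^sup>+\<xi>. ennreal (normal_density 0 s (x - \<xi>)) \<partial>N b \<partial>measure_pmf (bernoulli_pmf t))"
    unfolding H_def by (rule nn_integral_bind[OF _ NM]) simp
  also have "\<dots> = (\<integral>\<^sup>+b. ennreal (normal_mixture s (N b) x) \<partial>measure_pmf (bernoulli_pmf t))"
    by (simp only: ennreal_normal_mixture[OF N(1) s])
  also have "\<dots> = ennreal (normal_mixture s H1 x) * ennreal t + ennreal (normal_mixture s H0 x) * ennreal (1 - t)"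
    using t by (subst nn_integral_bernoulli_pmf) (auto simp: N_def)
  also have "\<dots> = ennreal ((1 - t) * normal_mixture s H0 x + t * normal_mixture s H1 x)"
    using t pos[of True] pos[of False] by (simp add: N_def ennreal_mult'[symmetric] ennreal_plus[symmetric] mult.commute add.commute del: ennreal_plus)
  finally show "normal_mixture s H x = (1 - t) * normal_mixture s H0 x + t * normal_mixture s H1 x"
    using t pos[of True] pos[of False] normal_mixture_pos[OF rd s, of x]
    by (subst (asm) ennreal_inj) (auto simp: N_def intro!: add_nonneg_nonneg)
qed

text \<open>A discrete layer-cake argument: \<open>x\<^sup>2\<close> is at most the sum of \<open>2 * (k + 1)\<close> over the natural numbers
  \<open>k < \<bar>x\<bar>\<close>.\<close>

lemma second_moment_of_exponential_tail:
  fixes p :: "real \<Rightarrow> real"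
  assumes p: "integrable lborel p" "\<And>x. 0 \<le> p x" and c2: "c2 > 0"
    and tail: "\<And>t. t > 0 \<Longrightarrow> (\<integral>x. indicator {x. \<bar>x\<bar> > t} x * p x \<partial>lborel) \<le> c1 * exp (- c2 * t)"
  shows "integrable lborel (\<lambda>x. p x * x\<^sup>2)"
proof -
  have [measurable]: "p \<in> borel_measurable borel" using p(1) by auto
  define I where "I = (\<lambda>k::nat. \<integral>x. indicator {x. \<bar>x\<bar> > real k} x * p x \<partial>lborel)"
  have int: "integrable lborel (\<lambda>x. indicator {x. \<bar>x\<bar> > real k} x * p x)" for k
    by (rule Bochner_Integration.integrable_bound[OF p(1)]) (use p(2) in \<open>auto simp: indicator_def\<close>)
  have I0: "I k \<ge> 0" for k unfolding I_def using p(2) by (intro integral_nonneg_AE) simp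
  have sq: "ennreal (x\<^sup>2) \<le> (\<Sum>k. ennreal (2 * real (Suc k) * indicator {x. \<bar>x\<bar> > real k} x))" for x
  proof -
    define m where "m = nat \<lceil>\<bar>x\<bar>\<rceil>"
    have m: "\<bar>x\<bar> \<le> real m" unfolding m_def by linarith
    have k: "\<bar>x\<bar> > real k" if "k < m" for k using that unfolding m_def by linarith
    have s: "(\<Sum>k<m. 2 * real (Suc k)) = real m * (real m + 1)"
      by (induction m) (auto simp: algebra_simps)
    have "\<bar>x\<bar> * \<bar>x\<bar> \<le> real m * (real m + 1)" using m by (intro mult_mono) auto
    then have "x\<^sup>2 \<le> (\<Sum>k<m. 2 * real (Suc k) * indicator {x. \<bar>x\<bar> > real k} x)"
      using k s by (simp add: power2_eq_square)
    then have "ennreal (x\<^sup>2) \<le> (\<Sum>k<m. ennreal (2 * real (Suc k) * indicator {x. \<bar>x\<bar> > real k} x))"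
      by (subst sum_ennreal) (auto intro: ennreal_leI)
    also have "\<dots> \<le> (\<Sum>k. ennreal (2 * real (Suc k) * indicator {x. \<bar>x\<bar> > real k} x))"
      by (rule sum_le_suminf) auto
    finally show ?thesis .
  qed
  have summ: "summable (\<lambda>k. 2 * real (Suc k) * I k)"
  proof (rule summable_comparison_test'[where N = 1])
    have "exp (- c2) < 1" using c2 by simp
    then have "summable (\<lambda>k. real (Suc k) * exp (- c2) ^ k)"
      using geometric_deriv_sums[of "exp (- c2)"] by (simp add: sums_iff)
    then show "summable (\<lambda>k. (2 * c1) * (real (Suc k) * exp (- c2) ^ k))" by (rule summable_mult)
    fix k :: nat assume "k \<ge> 1"
    then have "I k \<le> c1 * exp (- c2 * real k)" unfolding I_def by (intro tail) auto
    then have "I k \<le> c1 * exp (- c2) ^ k" by (simp add: exp_of_nat_mult[symmetric] mult.commute)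
    then have "2 * real (Suc k) * I k \<le> 2 * real (Suc k) * (c1 * exp (- c2) ^ k)" by (rule mult_left_mono) simp
    moreover have "norm (2 * real (Suc k) * I k) = 2 * real (Suc k) * I k" using I0[of k] by simp
    ultimately show "norm (2 * real (Suc k) * I k) \<le> (2 * c1) * (real (Suc k) * exp (- c2) ^ k)"
      by (simp only: mult_ac)
  qed
  have "(\<integral>\<^sup>+x. ennreal (p x * x\<^sup>2) \<partial>lborel)
      \<le> (\<integral>\<^sup>+x. (\<Sum>k. ennreal (2 * real (Suc k) * (indicator {x. \<bar>x\<bar> > real k} x * p x))) \<partial>lborel)"
  proof (rule nn_integral_mono)
    fix x
    have "ennreal (p x * x\<^sup>2) = ennreal (p x) * ennreal (x\<^sup>2)" using p(2) by (simp add: ennreal_mult)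
    also have "\<dots> \<le> ennreal (p x) * (\<Sum>k. ennreal (2 * real (Suc k) * indicator {x. \<bar>x\<bar> > real k} x))"
      by (rule mult_left_mono[OF sq]) simp
    also have "\<dots> = (\<Sum>k. ennreal (p x) * ennreal (2 * real (Suc k) * indicator {x. \<bar>x\<bar> > real k} x))"
      by (rule ennreal_suminf_cmult[symmetric])
    also have "\<dots> = (\<Sum>k. ennreal (2 * real (Suc k) * (indicator {x. \<bar>x\<bar> > real k} x * p x)))"
      using p(2) by (intro suminf_cong) (simp add: ennreal_mult[symmetric] mult_ac)
    finally show "ennreal (p x * x\<^sup>2) \<le> (\<Sum>k. ennreal (2 * real (Suc k) * (indicator {x. \<bar>x\<bar> > real k} x * p x)))" .
  qed
  also have "\<dots> = (\<Sum>k. \<integral>\<^sup>+x. ennreal (2 * real (Suc k) * (indicator {x. \<bar>x\<bar> > real k} x * p x)) \<partial>lborel)"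
    by (rule nn_integral_suminf) measurable
  also have "\<dots> = (\<Sum>k. ennreal (2 * real (Suc k) * I k))"
  proof (rule suminf_cong)
    fix k
    show "(\<integral>\<^sup>+x. ennreal (2 * real (Suc k) * (indicator {x. \<bar>x\<bar> > real k} x * p x)) \<partial>lborel) = ennreal (2 * real (Suc k) * I k)"
      unfolding I_def integral_mult_right_zero[symmetric]
      using p(2) by (intro nn_integral_eq_integral integrable_mult_right int) auto
  qed
  also have "\<dots> = ennreal (\<Sum>k. 2 * real (Suc k) * I k)"
    by (rule suminf_ennreal_eq[OF _ summable_sums[OF summ]]) (use I0 in simp)
  also have "\<dots> < \<infinity>" by (simp only: ennreal_less_top infinity_ennreal_def)
  finally show ?thesis
    using p(2) by (intro integrableI_nonneg) auto
qed

text \<open>The logarithm of a mixture falls off only quadratically, hence finite second moments of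
  \<open>p\<close> control the divergence from above; \<open>p - f \<le> p * ln (p / f)\<close> controls it from below.\<close>

lemma integrable_KL_integrand:
  assumes p: "integrable lborel p" "\<And>x. 0 < p x" "\<And>x. p x \<le> 1" "integrable lborel (\<lambda>x. p x * x\<^sup>2)"
    and H: "H \<in> borel_probs {-L..L}" and L: "L > 0" and s: "s > 0"
  shows "integrable lborel (\<lambda>x. p x * ln (p x / normal_mixture s H x))"
proof -
  note rd = borel_probsD(1)[OF H]
  interpret real_distribution H by (rule rd)
  let ?f = "normal_mixture s H"
  note [measurable] = measurable_normal_mixture[OF rd s]
  have [measurable]: "p \<in> borel_measurable borel" using p(1) by auto
  have f: "?f x > 0" for x by (rule normal_mixture_pos[OF rd s])
  define A where "A = \<bar>ln (sqrt (2 * pi * s\<^sup>2))\<bar> + L\<^sup>2 / s\<^sup>2"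
  have A: "A \<ge> 0" by (simp add: A_def)
  have lower: "- ln (?f x) \<le> A + x\<^sup>2 / s\<^sup>2" for x
  proof -
    define B where "B = - ln (sqrt (2 * pi * s\<^sup>2)) + - (x\<^sup>2 + L\<^sup>2) / s\<^sup>2"
    have sq: "sqrt (2 * pi * s\<^sup>2) > 0" using s by simp
    have "exp B \<le> normal_density 0 s (x - \<xi>)" if "\<xi> \<in> {-L..L}" for \<xi>
    proof -
      have "\<bar>\<xi>\<bar> \<le> \<bar>L\<bar>" using that by auto
      then have "\<xi>\<^sup>2 \<le> L\<^sup>2" by (simp only: abs_le_square_iff)
      moreover have "0 \<le> (x + \<xi>)\<^sup>2" by simp
      ultimately have "(x - \<xi>)\<^sup>2 \<le> 2 * (x\<^sup>2 + L\<^sup>2)" by (simp add: power2_eq_square algebra_simps)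
      then have "(x - \<xi>)\<^sup>2 / (2 * s\<^sup>2) \<le> 2 * (x\<^sup>2 + L\<^sup>2) / (2 * s\<^sup>2)" using s by (intro divide_right_mono) auto
      then have "- (x\<^sup>2 + L\<^sup>2) / s\<^sup>2 \<le> - (x - \<xi> - 0)\<^sup>2 / (2 * s\<^sup>2)"
        by (simp only: diff_zero minus_divide_left[symmetric] mult_divide_mult_cancel_left[OF numeral_neq_zero] neg_le_iff_le)
      moreover have "exp B = 1 / sqrt (2 * pi * s\<^sup>2) * exp (- (x\<^sup>2 + L\<^sup>2) / s\<^sup>2)"
        unfolding B_def exp_add exp_minus exp_ln[OF sq] by (simp add: divide_inverse)
      ultimately show ?thesis unfolding normal_density_def using sq by (simp add: divide_right_mono)
    qed
    moreover have "AE \<xi> in H. \<xi> \<in> {-L..L}" by (rule AE_borel_probs[OF H]) simp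
    ultimately have "AE \<xi> in H. exp B \<le> normal_density 0 s (x - \<xi>)" by (metis (no_types, lifting) eventually_mono)
    then have "(\<integral>\<xi>. exp B \<partial>H) \<le> ?f x"
      unfolding normal_mixture_def by (intro integral_mono_AE integrable_normal_kernel rd s) auto
    then have "exp B \<le> ?f x" by (simp add: prob_space[simplified])
    then have "B \<le> ln (?f x)" using f by (simp add: ln_ge_iff)
    moreover have "- A - x\<^sup>2 / s\<^sup>2 \<le> B" unfolding A_def B_def by (simp add: add_divide_distrib diff_divide_distrib)
    ultimately show ?thesis by simp
  qed
  show ?thesis
  proof (rule Bochner_Integration.integrable_bound)
    show "integrable lborel (\<lambda>x. A * p x + 1 / s\<^sup>2 * (p x * x\<^sup>2) + (p x + ?f x))"
      by (intro Bochner_Integration.integrable_add integrable_mult_right p integrable_normal_mixture rd s)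
    have "\<bar>p x * ln (p x / ?f x)\<bar> \<le> A * p x + 1 / s\<^sup>2 * (p x * x\<^sup>2) + (p x + ?f x)" for x
    proof -
      have "ln (p x) \<le> 0" using p(2,3) by (simp add: ln_le_zero_iff)
      moreover have "ln (p x / ?f x) = ln (p x) - ln (?f x)" using f[of x] p(2)[of x] by (simp add: ln_div)
      ultimately have "ln (p x / ?f x) \<le> A + x\<^sup>2 / s\<^sup>2" using lower[of x] by linarith
      then have "p x * ln (p x / ?f x) \<le> p x * (A + x\<^sup>2 / s\<^sup>2)"
        using p(2)[of x] by (intro mult_left_mono) auto
      then have up: "p x * ln (p x / ?f x) \<le> A * p x + 1 / s\<^sup>2 * (p x * x\<^sup>2)" by (simp add: algebra_simps)
      have "ln (?f x / p x) \<le> ?f x / p x - 1" using f p(2) by (intro ln_le_minus_one) simp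
      then have "p x * ln (?f x / p x) \<le> p x * (?f x / p x - 1)" using p(2)[of x] by (intro mult_left_mono) auto
      moreover have "ln (?f x / p x) = - ln (p x / ?f x)" using f[of x] p(2)[of x] by (simp add: ln_div)
      ultimately have lo: "- (p x * ln (p x / ?f x)) \<le> ?f x - p x"
        using p(2)[of x] by (simp add: right_diff_distrib)
      have "0 \<le> A * p x" "0 \<le> 1 / s\<^sup>2 * (p x * x\<^sup>2)" using A p(2)[of x] by auto
      then show ?thesis using up lo f[of x] p(2)[of x] by linarith
    qed
    then show "AE x in lborel. norm (p x * ln (p x / ?f x)) \<le> norm (A * p x + 1 / s\<^sup>2 * (p x * x\<^sup>2) + (p x + ?f x))"
      by (auto intro!: AE_I2 order_trans[OF _ abs_ge_self])
  qed measurable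
qed

text \<open>Moving from the projection \<open>f\<^sub>0\<close> a step \<open>t\<close> towards another mixture \<open>f\<^sub>1\<close> does not
  decrease the divergence, i.e. \<open>\<integral>p * ln (1 + t * (f\<^sub>1 / f\<^sub>0 - 1)) \<le> 0\<close>. Dividing by \<open>t\<close> and
  letting \<open>t\<close> tend to \<open>0\<close> gives the derivative. The ratio \<open>f\<^sub>1 / f\<^sub>0\<close> may grow exponentially,
  so its integrability under \<open>p\<close> is part of the conclusion and the limit is taken by Fatou's lemma;
  the estimate \<open>u / (1 + u) \<le> ln (1 + u)\<close> makes the difference quotient explicit.\<close>

lemma KL_projection_ratio_le_1:
  assumes p: "integrable lborel p" "(\<integral>x. p x \<partial>lborel) = 1" "\<And>x. 0 < p x" "\<And>x. p x \<le> 1"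
      "integrable lborel (\<lambda>x. p x * x\<^sup>2)"
    and H0: "H0 \<in> borel_probs {-L..L}" and H1: "H1 \<in> borel_probs {-L..L}" and L: "L > 0" and s: "s > 0"
    and min: "\<And>H. H \<in> borel_probs {-L..L} \<Longrightarrow> KL p (normal_mixture s H0) \<le> KL p (normal_mixture s H)"
  shows "(\<integral>\<^sup>+x. ennreal (p x * (normal_mixture s H1 x / normal_mixture s H0 x)) \<partial>lborel) \<le> 1"
proof -
  let ?f = "normal_mixture s"
  note rd0 = borel_probsD(1)[OF H0] and rd1 = borel_probsD(1)[OF H1]
  have [measurable]: "p \<in> borel_measurable borel" using p(1) by auto
  note [measurable] = measurable_normal_mixture[OF rd0 s] measurable_normal_mixture[OF rd1 s]
  have f0: "?f H0 x > 0" and f1: "?f H1 x > 0" for x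
    by (rule normal_mixture_pos[OF rd0 s], rule normal_mixture_pos[OF rd1 s])
  define r where "r x = ?f H1 x / ?f H0 x" for x
  have r: "r x > 0" for x using f0 f1 by (simp add: r_def)
  have [measurable]: "r \<in> borel_measurable borel" unfolding r_def[abs_def] by measurable
  define v where "v m x = (r x - 1) / (1 + (r x - 1) / (real m + 2))" for m :: nat and x
  have v: "v m x \<ge> -2" and step: "(\<integral>\<^sup>+x. ennreal (p x * (v m x + 2)) \<partial>lborel) \<le> 2" for m x
  proof -
    \<comment> \<open>A step of at most one half keeps \<open>1 + t * (r x - 1)\<close> away from zero, so the quotients have a
      common lower bound, as Fatou's lemma requires after adding \<open>2\<close>.\<close>
    define t where "t = 1 / (real m + 2)"
    have t: "0 < t" "t \<le> 1 / 2" by (auto simp: t_def field_simps)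
    have pos: "1 + t * (r x - 1) > 0" and half: "1 + t * (r x - 1) \<ge> 1 / 2" for x
    proof -
      have "0 \<le> t * r x" using t r[of x] by simp
      then show "1 + t * (r x - 1) \<ge> 1 / 2" unfolding right_diff_distrib using t by simp
      then show "1 + t * (r x - 1) > 0" by linarith
    qed
    have v_eq: "v m x = (r x - 1) / (1 + t * (r x - 1))" for x by (simp add: v_def t_def)
    have v2: "v m x \<ge> -2" for x
      using half[of x] r[of x] pos[of x] t
      unfolding v_eq by (simp add: pos_le_divide_eq)
    show "v m x \<ge> -2" by (rule v2)
    have t1: "0 \<le> t" "t \<le> 1" using t by auto
    obtain H where H: "H \<in> borel_probs {-L..L}"
      and mix': "\<And>s x. s > 0 \<Longrightarrow> normal_mixture s H x = (1 - t) * normal_mixture s H0 x + t * normal_mixture s H1 x"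
      using convex_borel_probs[OF H0 H1 atLeastAtMost_borel t1] by blast
    note mix = mix'[OF s]
    note rd = borel_probsD(1)[OF H]
    have f: "?f H x > 0" for x by (rule normal_mixture_pos[OF rd s])
    note [measurable] = measurable_normal_mixture[OF rd s]
    define u where "u x = p x * ln (1 + t * (r x - 1))" for x
    have fH: "?f H x = ?f H0 x * (1 + t * (r x - 1))" for x
      using f0[of x] by (simp add: mix r_def field_simps)
    have u_eq: "u x = p x * ln (p x / ?f H0 x) - p x * ln (p x / ?f H x)" for x
    proof -
      have "ln (p x / ?f H0 x) = ln (p x) - ln (?f H0 x)" using p(3)[of x] f0[of x] by (simp add: ln_div)
      moreover have "ln (p x / ?f H x) = ln (p x) - ln (?f H x)" using p(3)[of x] f[of x] by (simp add: ln_div)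
      moreover have "ln (?f H x) = ln (?f H0 x) + ln (1 + t * (r x - 1))"
        unfolding fH using f0[of x] pos[of x] by (rule ln_mult_pos)
      ultimately show ?thesis unfolding u_def by (simp add: right_diff_distrib distrib_left)
    qed
    have i0: "integrable lborel (\<lambda>x. p x * ln (p x / ?f H0 x))"
      and i1: "integrable lborel (\<lambda>x. p x * ln (p x / ?f H x))"
      using integrable_KL_integrand[OF p(1,3,4,5) _ L s] H0 H by auto
    have u_int: "integrable lborel u" unfolding u_eq using i0 i1 by (rule Bochner_Integration.integrable_diff)
    have "KL p (?f H0) = (\<integral>x. p x * ln (p x / ?f H0 x) \<partial>lborel)"
      "KL p (?f H) = (\<integral>x. p x * ln (p x / ?f H x) \<partial>lborel)"
      using p(3) f0 f by (auto intro!: KL_eq_integral simp: less_imp_le)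
    then have u0: "integral\<^sup>L lborel u \<le> 0"
      unfolding u_eq using min[OF H] i0 i1 by simp
    have vu: "p x * (v m x + 2) \<le> u x / t + 2 * p x" for x
    proof -
      have "ln (inverse (1 + t * (r x - 1))) \<le> inverse (1 + t * (r x - 1)) - 1"
        using pos[of x] by (intro ln_le_minus_one) simp
      then have "1 - inverse (1 + t * (r x - 1)) \<le> ln (1 + t * (r x - 1))"
        using pos[of x] by (simp add: ln_inverse)
      moreover have "1 - inverse (1 + t * (r x - 1)) = t * v m x"
        unfolding v_eq using pos[of x] by (simp add: field_simps)
      ultimately have "v m x \<le> ln (1 + t * (r x - 1)) / t" using t by (simp add: pos_le_divide_eq mult.commute)
      then have "p x * v m x \<le> p x * (ln (1 + t * (r x - 1)) / t)" using p(3)[of x] by (intro mult_left_mono) auto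
      then show ?thesis by (simp add: u_def distrib_left)
    qed
    have pv0: "0 \<le> p x * (v m x + 2)" for x using v2[of x] p(3)[of x] by simp
    have "(\<integral>\<^sup>+x. ennreal (p x * (v m x + 2)) \<partial>lborel) \<le> (\<integral>\<^sup>+x. ennreal (u x / t + 2 * p x) \<partial>lborel)"
      using vu by (intro nn_integral_mono ennreal_leI) auto
    also have "\<dots> = ennreal (\<integral>x. u x / t + 2 * p x \<partial>lborel)"
      using u_int p(1) order_trans[OF pv0 vu] by (intro nn_integral_eq_integral) auto
    also have "(\<integral>x. u x / t + 2 * p x \<partial>lborel) = integral\<^sup>L lborel u / t + 2"
      using u_int p(1,2) by simp
    also have "ennreal \<dots> \<le> ennreal 2"
      using u0 t by (intro ennreal_leI) (simp add: divide_nonpos_pos)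
    finally show "(\<integral>\<^sup>+x. ennreal (p x * (v m x + 2)) \<partial>lborel) \<le> 2" by simp
  qed
  have [measurable]: "v m \<in> borel_measurable borel" for m unfolding v_def[abs_def] by measurable
  have lim: "(\<lambda>m. v m x) \<longlonglongrightarrow> r x - 1" for x
  proof -
    have "(\<lambda>m. (r x - 1) / (real m + 2)) \<longlonglongrightarrow> 0" by real_asymp
    then have "(\<lambda>m. (r x - 1) / (1 + (r x - 1) / (real m + 2))) \<longlonglongrightarrow> (r x - 1) / (1 + 0)"
      by (intro tendsto_intros) simp_all
    then show ?thesis by (simp add: v_def)
  qed
  have "(\<integral>\<^sup>+x. ennreal (p x * (r x + 1)) \<partial>lborel) = (\<integral>\<^sup>+x. liminf (\<lambda>m. ennreal (p x * (v m x + 2))) \<partial>lborel)"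
  proof (rule nn_integral_cong)
    fix x
    have "(\<lambda>m. ennreal (p x * (v m x + 2))) \<longlonglongrightarrow> ennreal (p x * ((r x - 1) + 2))"
      by (intro tendsto_ennrealI tendsto_mult tendsto_add lim tendsto_const)
    then show "ennreal (p x * (r x + 1)) = liminf (\<lambda>m. ennreal (p x * (v m x + 2)))"
      by (simp add: lim_imp_Liminf add.commute)
  qed
  also have "\<dots> \<le> liminf (\<lambda>m. \<integral>\<^sup>+x. ennreal (p x * (v m x + 2)) \<partial>lborel)"
    by (rule nn_integral_liminf) measurable
  also have "\<dots> \<le> liminf (\<lambda>m::nat. 2)"
    by (rule Liminf_mono) (simp add: step)
  also have "\<dots> = 2" by (simp add: Liminf_const)
  finally have "(\<integral>\<^sup>+x. ennreal (p x * r x) + ennreal (p x) \<partial>lborel) \<le> 2"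
    using p(3) r by (simp add: distrib_left ennreal_plus[symmetric] less_imp_le del: ennreal_plus)
  then have "(\<integral>\<^sup>+x. ennreal (p x * r x) \<partial>lborel) + 1 \<le> 1 + 1"
    using p by (subst (asm) nn_integral_add) (auto simp: nn_integral_eq_integral less_imp_le)
  then have "1 + (\<integral>\<^sup>+x. ennreal (p x * r x) \<partial>lborel) \<le> 1 + 1"
    by (subst add.commute)
  then show ?thesis unfolding ennreal_add_left_cancel_le r_def by simp
qed

section \<open>Likelihood ratios far from the projection\<close>

text \<open>A Hellinger-type bound under misspecification. The optimality condition plays the role of
  \<open>\<integral>f\<^sub>1 = 1\<close> in the well-specified case, and \<open>f\<^sub>0 \<le> C * p\<close> turns the \<open>p\<close>-weighted distance of the
  square roots into an unweighted one.\<close>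

lemma nn_integral_sqrt_ratio_le:
  fixes p f0 f1 :: "real \<Rightarrow> real"
  assumes [measurable]: "p \<in> borel_measurable borel" "f0 \<in> borel_measurable borel" "f1 \<in> borel_measurable borel"
    and p: "\<And>x. 0 < p x" "(\<integral>\<^sup>+x. ennreal (p x) \<partial>lborel) = 1"
    and f0: "\<And>x. 0 < f0 x" "\<And>x. f0 x \<le> 1" and f1: "\<And>x. 0 < f1 x" "\<And>x. f1 x \<le> 1"
    and C: "C > 0" "\<And>x. f0 x \<le> C * p x"
    and opt: "(\<integral>\<^sup>+x. ennreal (p x * (f1 x / f0 x)) \<partial>lborel) \<le> 1"
    and int: "integrable lborel (\<lambda>x. (f1 x - f0 x)\<^sup>2)"
  shows "(\<integral>\<^sup>+x. ennreal (p x * sqrt (f1 x / f0 x)) \<partial>lborel)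
    \<le> ennreal (exp (- (\<integral>x. (f1 x - f0 x)\<^sup>2 \<partial>lborel) / (8 * C)))"
proof -
  define I where "I = (\<integral>x. (f1 x - f0 x)\<^sup>2 \<partial>lborel) / (8 * C)"
  have I: "I \<ge> 0" using C by (simp add: I_def integral_nonneg_AE)
  have pointwise: "p x * sqrt (f1 x / f0 x) + (f1 x - f0 x)\<^sup>2 / (8 * C) \<le> p x / 2 + p x * (f1 x / f0 x) / 2" for x
  proof -
    define u v where "u = sqrt (f1 x)" and "v = sqrt (f0 x)"
    have uv: "u > 0" "v > 0" "u \<le> 1" "v \<le> 1" "f1 x = u\<^sup>2" "f0 x = v\<^sup>2"
      using f0[of x] f1[of x] by (simp_all add: u_def v_def less_imp_le)
    have "(u + v)\<^sup>2 \<le> 2\<^sup>2" using uv by (intro power_mono) auto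
    then have "(u - v)\<^sup>2 * (u + v)\<^sup>2 \<le> (u - v)\<^sup>2 * 4" by (intro mult_left_mono) auto
    moreover have "(f1 x - f0 x)\<^sup>2 = (u - v)\<^sup>2 * (u + v)\<^sup>2"
      unfolding uv by (simp add: power2_eq_square algebra_simps)
    ultimately have "(f1 x - f0 x)\<^sup>2 / (8 * C) \<le> (u - v)\<^sup>2 * 4 / (8 * C)"
      using C by (intro divide_right_mono) auto
    also have "\<dots> = (u - v)\<^sup>2 / v\<^sup>2 * (v\<^sup>2 / C) / 2" using uv C by simp
    also have "\<dots> \<le> (u - v)\<^sup>2 / v\<^sup>2 * p x / 2"
    proof -
      have "v\<^sup>2 / C \<le> p x" using C(2)[of x] C(1) by (simp add: uv pos_divide_le_eq mult.commute)
      then show ?thesis by (intro divide_right_mono mult_left_mono) auto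
    qed
    finally have 1: "(f1 x - f0 x)\<^sup>2 / (8 * C) \<le> (u - v)\<^sup>2 / v\<^sup>2 * p x / 2" .
    define q z where "q = u / v" and "z = f1 x / f0 x"
    have "sqrt (f1 x / f0 x) = q" by (simp add: q_def u_def v_def real_sqrt_divide)
    moreover have "(u - v)\<^sup>2 / v\<^sup>2 = z - 2 * q + 1"
      unfolding uv q_def z_def using uv(2) by (simp add: power2_eq_square field_simps)
    moreover have "(z - 2 * q + 1) * p x / 2 = p x / 2 + p x * z / 2 - p x * q"
      by (simp add: field_simps)
    ultimately show ?thesis using 1 unfolding z_def[symmetric] by simp
  qed
  let ?X = "\<integral>\<^sup>+x. ennreal (p x * sqrt (f1 x / f0 x)) \<partial>lborel"
  have nonneg: "0 \<le> p x * sqrt (f1 x / f0 x)" "0 \<le> (f1 x - f0 x)\<^sup>2 / (8 * C)" "0 \<le> p x * (f1 x / f0 x)" for x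
    using p(1)[of x] f0(1)[of x] f1(1)[of x] C by auto
  have "?X + ennreal I = ?X + (\<integral>\<^sup>+x. ennreal ((f1 x - f0 x)\<^sup>2 / (8 * C)) \<partial>lborel)"
    unfolding I_def integral_divide_zero[symmetric]
    using int nonneg by (subst nn_integral_eq_integral) auto
  also have "\<dots> = (\<integral>\<^sup>+x. ennreal (p x * sqrt (f1 x / f0 x) + (f1 x - f0 x)\<^sup>2 / (8 * C)) \<partial>lborel)"
    using nonneg by (subst nn_integral_add[symmetric]) (auto simp: ennreal_plus)
  also have "\<dots> \<le> (\<integral>\<^sup>+x. ennreal (p x / 2 + p x * (f1 x / f0 x) / 2) \<partial>lborel)"
    by (intro nn_integral_mono ennreal_leI pointwise)
  also have "\<dots> = (\<integral>\<^sup>+x. ennreal (1 / 2) * (ennreal (p x) + ennreal (p x * (f1 x / f0 x))) \<partial>lborel)"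
  proof (rule nn_integral_cong)
    fix x
    have "p x / 2 + p x * (f1 x / f0 x) / 2 = 1 / 2 * (p x + p x * (f1 x / f0 x))" by (simp add: distrib_left)
    then show "ennreal (p x / 2 + p x * (f1 x / f0 x) / 2) = ennreal (1 / 2) * (ennreal (p x) + ennreal (p x * (f1 x / f0 x)))"
      using p(1)[of x] nonneg(3)[of x] by (simp only: ennreal_mult ennreal_plus less_imp_le add_nonneg_nonneg zero_le_divide_1_iff zero_le_numeral)
  qed
  also have "\<dots> = ennreal (1 / 2) * (1 + (\<integral>\<^sup>+x. ennreal (p x * (f1 x / f0 x)) \<partial>lborel))"
    by (subst nn_integral_cmult) (auto simp: nn_integral_add p)
  also have "\<dots> \<le> ennreal (1 / 2) * (1 + 1)"
    using opt by (intro mult_left_mono add_left_mono) auto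
  also have "\<dots> = ennreal (1 / 2 * 2)" by (subst ennreal_mult) auto
  finally have *: "?X + ennreal I \<le> 1" by simp
  then have "?X \<noteq> \<top>" by (auto simp: top_unique)
  then obtain X where X: "X \<ge> 0" "?X = ennreal X" by (cases ?X) auto
  have "X + I \<le> 1" using * X I by (simp add: ennreal_plus[symmetric] del: ennreal_plus)
  moreover have "1 + - I \<le> exp (- I)" by (rule exp_ge_add_one_self)
  ultimately have "X \<le> exp (- I)" by linarith
  then show ?thesis unfolding X I_def by (simp add: ennreal_leI)
qed

text \<open>Markov's inequality for the square root of the likelihood ratio, whose expectation factorises by
  independence. The threshold \<open>exp (- 1 / 2)\<close> corresponds to a log-likelihood ratio of \<open>- 1\<close>, the loss
  incurred later by passing to a net.\<close>

lemma (in prob_space) likelihood_ratio_deviation: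
  fixes r p :: "real \<Rightarrow> real"
  assumes X: "indep_vars (\<lambda>_. borel) X UNIV" and distr: "\<And>i. distributed M lborel (X i) (\<lambda>x. ennreal (p x))"
    and p: "\<And>x. 0 \<le> p x"
    and [measurable]: "r \<in> borel_measurable borel" and r: "\<And>x. 0 \<le> r x"
    and bd: "(\<integral>\<^sup>+x. ennreal (p x * sqrt (r x)) \<partial>lborel) \<le> ennreal (exp (- d))"
  shows "prob {\<omega> \<in> space M. exp (- 1 / 2) \<le> (\<Prod>i<n. sqrt (r (X i \<omega>)))} \<le> exp (1 / 2) * exp (- real n * d)"
    and "{\<omega> \<in> space M. exp (- 1 / 2) \<le> (\<Prod>i<n. sqrt (r (X i \<omega>)))} \<in> sets M"
proof -
  have [measurable]: "X i \<in> borel_measurable M" for i using X by (auto simp: indep_vars_def)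
  have [measurable]: "(\<lambda>x. ennreal (p x)) \<in> borel_measurable borel"
    using distributed_borel_measurable[OF distr] by simp
  show "{\<omega> \<in> space M. exp (- 1 / 2) \<le> (\<Prod>i<n. sqrt (r (X i \<omega>)))} \<in> sets M"
    by measurable
  have ind: "indep_vars (\<lambda>_. borel) (\<lambda>i \<omega>. ennreal (sqrt (r (X i \<omega>)))) {..<n}"
    by (rule indep_vars_compose2[OF indep_vars_subset[OF X]]) auto
  have one: "(\<integral>\<^sup>+\<omega>. ennreal (sqrt (r (X i \<omega>))) \<partial>M) \<le> ennreal (exp (- d))" for i
  proof -
    have "(\<integral>\<^sup>+\<omega>. ennreal (sqrt (r (X i \<omega>))) \<partial>M) = (\<integral>\<^sup>+x. ennreal (p x) * ennreal (sqrt (r x)) \<partial>lborel)"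
      by (rule distributed_nn_integral[OF distr, symmetric]) measurable
    also have "\<dots> = (\<integral>\<^sup>+x. ennreal (p x * sqrt (r x)) \<partial>lborel)"
      using p r by (simp add: ennreal_mult)
    finally show ?thesis using bd by simp
  qed
  have "(\<integral>\<^sup>+\<omega>. ennreal (\<Prod>i<n. sqrt (r (X i \<omega>))) \<partial>M) = (\<integral>\<^sup>+\<omega>. (\<Prod>i<n. ennreal (sqrt (r (X i \<omega>)))) \<partial>M)"
    using r by (simp add: prod_ennreal)
  also have "\<dots> = (\<Prod>i<n. \<integral>\<^sup>+\<omega>. ennreal (sqrt (r (X i \<omega>))) \<partial>M)"
    by (rule indep_vars_nn_integral[OF _ ind]) auto
  also have "\<dots> \<le> (\<Prod>i<n. ennreal (exp (- d)))"
    by (induction n) (auto simp: one simp del: prod_constant intro!: mult_mono)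
  also have "\<dots> = ennreal (exp (- real n * d))"
    by (simp add: prod_ennreal exp_of_nat_mult[symmetric] ennreal_power)
  finally have int: "(\<integral>\<^sup>+\<omega>. ennreal (\<Prod>i<n. sqrt (r (X i \<omega>))) \<partial>M) \<le> ennreal (exp (- real n * d))" .
  have "ennreal (prob {\<omega> \<in> space M. exp (- 1 / 2) \<le> (\<Prod>i<n. sqrt (r (X i \<omega>)))})
      = (\<integral>\<^sup>+\<omega>. indicator {\<omega> \<in> space M. exp (- 1 / 2) \<le> (\<Prod>i<n. sqrt (r (X i \<omega>)))} \<omega> \<partial>M)"
    by (subst nn_integral_indicator) (auto simp: emeasure_eq_measure)
  also have "\<dots> \<le> (\<integral>\<^sup>+\<omega>. ennreal (exp (1 / 2)) * ennreal (\<Prod>i<n. sqrt (r (X i \<omega>))) \<partial>M)"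
  proof (rule nn_integral_mono)
    fix \<omega>
    show "indicator {\<omega> \<in> space M. exp (- 1 / 2) \<le> (\<Prod>i<n. sqrt (r (X i \<omega>)))} \<omega>
        \<le> ennreal (exp (1 / 2)) * ennreal (\<Prod>i<n. sqrt (r (X i \<omega>)))"
    proof (cases "exp (- 1 / 2) \<le> (\<Prod>i<n. sqrt (r (X i \<omega>)))")
      case True
      have "1 = exp (1 / 2) * exp (- 1 / 2 :: real)" by (simp add: exp_add[symmetric])
      also have "\<dots> \<le> exp (1 / 2) * (\<Prod>i<n. sqrt (r (X i \<omega>)))" using True by (intro mult_left_mono) auto
      finally have "1 \<le> ennreal (exp (1 / 2) * (\<Prod>i<n. sqrt (r (X i \<omega>))))" by simp
      also have "\<dots> = ennreal (exp (1 / 2)) * ennreal (\<Prod>i<n. sqrt (r (X i \<omega>)))"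
        using r by (intro ennreal_mult prod_nonneg) auto
      finally show ?thesis by (auto simp: indicator_def)
    qed (auto simp: indicator_def)
  qed
  also have "\<dots> = ennreal (exp (1 / 2)) * (\<integral>\<^sup>+\<omega>. ennreal (\<Prod>i<n. sqrt (r (X i \<omega>))) \<partial>M)"
    by (rule nn_integral_cmult) measurable
  also have "\<dots> \<le> ennreal (exp (1 / 2)) * ennreal (exp (- real n * d))"
    by (rule mult_left_mono[OF int]) simp
  also have "\<dots> = ennreal (exp (1 / 2) * exp (- real n * d))" by (simp add: ennreal_mult)
  finally show "prob {\<omega> \<in> space M. exp (- 1 / 2) \<le> (\<Prod>i<n. sqrt (r (X i \<omega>)))} \<le> exp (1 / 2) * exp (- real n * d)"
    by (subst (asm) ennreal_le_iff) auto
qed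

section \<open>The rate of the maximum likelihood estimator\<close>

text \<open>If the estimator falls into the set \<open>S\<close> of mixing measures far from the projection, then
  so does a nearby member of the finite net, and its likelihood ratio against the projection is at
  least \<open>exp (- 1)\<close>, unless an observation leaves \<open>[-R, R]\<close>. Each of the finitely many members of
  the net does so with exponentially small probability.\<close>

lemma (in prob_space) npmle_far_from_projection:
  fixes p :: "real \<Rightarrow> real"
  assumes X: "indep_vars (\<lambda>_. borel) X UNIV" and distr: "\<And>i. distributed M lborel (X i) (\<lambda>x. ennreal (p x))"
    and p: "\<And>x. 0 \<le> p x"
    and tail: "\<And>i. prob {\<omega> \<in> space M. \<bar>X i \<omega>\<bar> > R} \<le> \<tau>"
    and L: "L > 0" and R: "R \<ge> 0" and n: "n \<ge> 1"
    and H0: "H0 \<in> borel_probs {-L..L}" and S: "S \<subseteq> borel_probs {-L..L}"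
    and sqrt_ratio: "\<And>H. H \<in> S \<Longrightarrow>
      (\<integral>\<^sup>+x. ennreal (p x * sqrt (f_dens c H x / f_dens c H0 x)) \<partial>lborel) \<le> ennreal (exp (- d))"
    and Y_def: "Y = R * L / (sigma_star c)\<^sup>2" and b_def: "b = L\<^sup>2 / (2 * (sigma_star c)\<^sup>2)"
    and N: "real N \<ge> 5 * Y + b + ln (4 * real n)"
    and npmle: "\<And>\<omega>. \<omega> \<in> space M \<Longrightarrow> is_npmle c L n (\<lambda>i. X i \<omega>) (Hhat \<omega>)"
  obtains A where "A \<in> sets M" "{\<omega> \<in> space M. Hhat \<omega> \<in> S} \<subseteq> A"
    and "prob A \<le> real n * \<tau> + (8 * real n * exp (2 * Y + b)) ^ N * (exp (1 / 2) * exp (- real n * d))"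
proof -
  have [measurable]: "X i \<in> borel_measurable M" for i using X by (auto simp: indep_vars_def)
  note sp = sigma_star_pos[of c]
  have n0: "real n > 0" using n by simp
  have pos: "f_dens c H x > 0" if "H \<in> borel_probs {-L..L}" for H x
    unfolding f_dens_def by (rule normal_mixture_pos[OF borel_probsD(1)[OF that] sp])
  have meas: "f_dens c H \<in> borel_measurable borel" if "H \<in> borel_probs {-L..L}" for H
    unfolding f_dens_def by (rule measurable_normal_mixture[OF borel_probsD(1)[OF that] sp])
  have eps: "0 < 1 / real n" "1 / real n \<le> 1" using n by auto
  obtain T where T: "finite T" "T \<subseteq> S" "real (card T) \<le> (8 / (1 / real n) * exp (2 * Y + b)) ^ N"
    and near: "\<And>H. H \<in> S \<Longrightarrow> \<exists>K\<in>T. \<forall>x. \<bar>x\<bar> \<le> R \<longrightarrow>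
      normal_mixture (sigma_star c) H x \<le> (1 + 1 / real n) * normal_mixture (sigma_star c) K x"
    using finite_likelihood_net[OF sp L R eps S Y_def b_def, of N] N by (auto simp: divide_inverse)
  define out where "out i = {\<omega> \<in> space M. \<bar>X i \<omega>\<bar> > R}" for i
  define bad where "bad K = {\<omega> \<in> space M. exp (- 1 / 2) \<le> (\<Prod>i<n. sqrt (f_dens c K (X i \<omega>) / f_dens c H0 (X i \<omega>)))}" for K
  have bad: "prob (bad K) \<le> exp (1 / 2) * exp (- real n * d)" "bad K \<in> sets M" if "K \<in> T" for K
  proof -
    have K: "K \<in> S" "K \<in> borel_probs {-L..L}" using that T(2) S by auto
    note [measurable] = meas[OF K(2)] meas[OF H0]
    note * = likelihood_ratio_deviation[OF X distr p _ _ sqrt_ratio[OF K(1)], of n]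
    show "prob (bad K) \<le> exp (1 / 2) * exp (- real n * d)"
      unfolding bad_def by (rule *(1)) (use pos[OF K(2)] pos[OF H0] in \<open>auto simp: less_imp_le\<close>)
    show "bad K \<in> sets M"
      unfolding bad_def by (rule *(2)) (use pos[OF K(2)] pos[OF H0] in \<open>auto simp: less_imp_le\<close>)
  qed
  have out: "out i \<in> sets M" for i unfolding out_def by measurable
  define A where "A = (\<Union>i<n. out i) \<union> (\<Union>K\<in>T. bad K)"
  show ?thesis
  proof
    show "A \<in> sets M" unfolding A_def using T(1) bad(2) out by auto
    have "prob A \<le> prob (\<Union>i<n. out i) + prob (\<Union>K\<in>T. bad K)"
      unfolding A_def using T(1) bad(2) out by (intro measure_Un_le) auto
    also have "prob (\<Union>i<n. out i) \<le> (\<Sum>i<n. prob (out i))"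
      using out by (intro measure_UNION_le) auto
    also have "\<dots> \<le> (\<Sum>i<n. \<tau>)" unfolding out_def by (rule sum_mono[OF tail])
    also have "prob (\<Union>K\<in>T. bad K) \<le> (\<Sum>K\<in>T. prob (bad K))"
      using bad(2) T(1) by (intro measure_UNION_le) auto
    also have "\<dots> \<le> (\<Sum>K\<in>T. exp (1 / 2) * exp (- real n * d))" by (rule sum_mono[OF bad(1)])
    also have "\<dots> = real (card T) * (exp (1 / 2) * exp (- real n * d))" by simp
    also have "\<dots> \<le> (8 * real n * exp (2 * Y + b)) ^ N * (exp (1 / 2) * exp (- real n * d))"
      using T(3) by (intro mult_right_mono) auto
    finally show "prob A \<le> real n * \<tau> + (8 * real n * exp (2 * Y + b)) ^ N * (exp (1 / 2) * exp (- real n * d))"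
      by simp
    show "{\<omega> \<in> space M. Hhat \<omega> \<in> S} \<subseteq> A"
    proof (rule subsetI, rule ccontr)
      fix \<omega> assume "\<omega> \<in> {\<omega> \<in> space M. Hhat \<omega> \<in> S}" and notA: "\<omega> \<notin> A"
      then have \<omega>: "\<omega> \<in> space M" and HS: "Hhat \<omega> \<in> S" by auto
      define x where "x = (\<lambda>i. X i \<omega>)"
      have x: "\<bar>x i\<bar> \<le> R" if "i < n" for i
        using notA \<omega> that by (auto simp: A_def out_def x_def not_less)
      obtain K where K: "K \<in> T" and le: "\<And>x. \<bar>x\<bar> \<le> R \<Longrightarrow> f_dens c (Hhat \<omega>) x \<le> (1 + 1 / real n) * f_dens c K x"
        using near[OF HS] unfolding f_dens_def by blast
      have Kb: "K \<in> borel_probs {-L..L}" and Hb: "Hhat \<omega> \<in> borel_probs {-L..L}" using K T(2) HS S by auto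
      have "(\<Sum>i<n. ln (f_dens c H0 (x i))) \<le> (\<Sum>i<n. ln (f_dens c (Hhat \<omega>) (x i)))"
        using npmle[OF \<omega>] H0 unfolding is_npmle_def is_arg_max_def x_def[symmetric] by (auto simp: not_less)
      also have "\<dots> \<le> (\<Sum>i<n. 1 / real n + ln (f_dens c K (x i)))"
      proof (rule sum_mono)
        fix i assume "i \<in> {..<n}"
        then have "f_dens c (Hhat \<omega>) (x i) \<le> (1 + 1 / real n) * f_dens c K (x i)" by (intro le x) auto
        then have "ln (f_dens c (Hhat \<omega>) (x i)) \<le> ln ((1 + 1 / real n) * f_dens c K (x i))"
          using pos[OF Hb, of "x i"] pos[OF Kb, of "x i"] n0 by (subst ln_le_cancel_iff) (auto intro!: mult_pos_pos add_pos_pos)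
        also have "\<dots> = ln (1 + 1 / real n) + ln (f_dens c K (x i))"
          using pos[OF Kb, of "x i"] n0 by (intro ln_mult_pos) (auto intro!: add_pos_pos)
        also have "ln (1 + 1 / real n) \<le> 1 / real n" by (rule ln_add_one_self_le_self) simp
        finally show "ln (f_dens c (Hhat \<omega>) (x i)) \<le> 1 / real n + ln (f_dens c K (x i))" by simp
      qed
      also have "\<dots> = 1 + (\<Sum>i<n. ln (f_dens c K (x i)))" using n0 by (simp add: sum.distrib)
      finally have ge: "- 1 \<le> (\<Sum>i<n. ln (f_dens c K (x i)) - ln (f_dens c H0 (x i)))"
        by (simp add: sum_subtractf)
      have "(\<Prod>i<n. sqrt (f_dens c K (x i) / f_dens c H0 (x i)))
          = (\<Prod>i<n. exp ((ln (f_dens c K (x i)) - ln (f_dens c H0 (x i))) / 2))"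
      proof (rule prod.cong[OF refl])
        fix i
        let ?u = "(ln (f_dens c K (x i)) - ln (f_dens c H0 (x i))) / 2"
        have "(exp ?u)\<^sup>2 = exp (ln (f_dens c K (x i)) - ln (f_dens c H0 (x i)))"
          by (simp add: power2_eq_square exp_add[symmetric])
        also have "\<dots> = f_dens c K (x i) / f_dens c H0 (x i)"
          using pos[OF Kb, of "x i"] pos[OF H0, of "x i"] by (simp add: exp_diff)
        finally show "sqrt (f_dens c K (x i) / f_dens c H0 (x i)) = exp ?u"
          by (intro real_sqrt_unique) auto
      qed
      also have "\<dots> = exp ((\<Sum>i<n. ln (f_dens c K (x i)) - ln (f_dens c H0 (x i))) / 2)"
        by (simp add: exp_sum sum_divide_distrib)
      also have "\<dots> \<ge> exp (- 1 / 2)" using ge by simp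
      finally have "\<omega> \<in> bad K" using \<omega> by (simp add: bad_def x_def)
      then show False using notA K by (auto simp: A_def)
    qed
  qed
qed

text \<open>The bound of the previous lemma with an observation range \<open>R\<close> proportional to \<open>ln n\<close>. Then
  \<open>N\<close> and the logarithm of the number of grid points per moment are \<open>O (ln n)\<close>, so the net has only
  \<open>exp (O ((ln n)\<^sup>2))\<close> members, which is outweighed by the exponent \<open>n * q_rate n = (ln n)^4\<close>.\<close>

lemma union_bound_exponent_le:
  fixes y b D :: real
  assumes y: "y \<ge> 0" and b: "b \<ge> 0" and n: "n \<ge> 3"
    and D: "D = (5 * y + b + 4) * (2 * y + b + 4)"
    and N: "N = nat \<lceil>5 * (y * ln (real n)) + b + ln (4 * real n)\<rceil>"
  shows "(8 * real n * exp (2 * (y * ln (real n)) + b)) ^ N * (exp (1 / 2) * exp (- (D + 1) * ln (real n) ^ 4))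
    \<le> exp (1 / 2 - (ln (real n))\<^sup>2)"
proof -
  define l where "l = ln (real n)"
  have n0: "real n > 0" using n by simp
  have "exp 1 \<le> real n" using exp_le n by (intro order_trans[OF exp_le]) simp
  then have l1: "l \<ge> 1" unfolding l_def using n0 by (simp add: ln_ge_iff)
  have bl: "b \<le> b * l" using mult_left_mono[OF l1 b] by simp
  have l4: "ln (4::real) \<le> 2" "ln (8::real) \<le> 3"
  proof -
    have "2 \<le> exp (1::real)" using exp_ge_add_one_self[of 1] by simp
    then have "2 ^ 2 \<le> exp (1::real) ^ 2" "2 ^ 3 \<le> exp (1::real) ^ 3" by (intro power_mono; simp)+
    then have "4 \<le> exp (2::real)" "8 \<le> exp (3::real)" by (simp_all add: exp_of_nat_mult[symmetric])
    then have "ln 4 \<le> ln (exp (2::real))" "ln 8 \<le> ln (exp (3::real))" by (subst ln_le_cancel_iff; simp)+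
    then show "ln (4::real) \<le> 2" "ln (8::real) \<le> 3" by simp_all
  qed
  have ln4n: "ln (4 * real n) = ln 4 + l" and ln8n: "ln (8 * real n) = ln 8 + l"
    using n0 by (simp_all add: l_def ln_mult_pos)
  have "0 \<le> 5 * (y * l) + b + ln (4 * real n)"
    using y b l1 n0 n by (intro add_nonneg_nonneg mult_nonneg_nonneg) auto
  then have "real N \<le> 5 * (y * l) + b + ln (4 * real n) + 1" unfolding N l_def by linarith
  also have "\<dots> \<le> (5 * y + b + 4) * l" using l4 l1 bl unfolding ln4n by (simp add: algebra_simps)
  finally have N: "real N \<le> (5 * y + b + 4) * l" .
  have base: "8 * real n * exp (2 * (y * l) + b) = exp (ln (8 * real n) + (2 * (y * l) + b))"
    using n0 by (simp add: exp_add)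
  have "ln (8 * real n) + (2 * (y * l) + b) \<le> (2 * y + b + 4) * l"
    using l4 l1 bl unfolding ln8n by (simp add: algebra_simps)
  then have "8 * real n * exp (2 * (y * l) + b) \<le> exp ((2 * y + b + 4) * l)"
    unfolding base by simp
  then have "(8 * real n * exp (2 * (y * l) + b)) ^ N \<le> exp ((2 * y + b + 4) * l) ^ N"
    by (rule power_mono) simp
  also have "\<dots> = exp (real N * ((2 * y + b + 4) * l))" by (simp only: exp_of_nat_mult)
  also have "\<dots> \<le> exp (((5 * y + b + 4) * l) * ((2 * y + b + 4) * l))"
    using y b l1 by (intro exp_mono mult_right_mono[OF N] mult_nonneg_nonneg) auto
  also have "((5 * y + b + 4) * l) * ((2 * y + b + 4) * l) = D * l\<^sup>2"
    by (simp add: D power2_eq_square algebra_simps)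
  finally have "(8 * real n * exp (2 * (y * l) + b)) ^ N * (exp (1 / 2) * exp (- (D + 1) * l ^ 4))
      \<le> exp (D * l\<^sup>2) * (exp (1 / 2) * exp (- (D + 1) * l ^ 4))"
    by (rule mult_right_mono) simp
  also have "\<dots> = exp (1 / 2 + (D * l\<^sup>2 - (D + 1) * l ^ 4))"
    by (simp add: exp_add[symmetric] algebra_simps)
  also have "\<dots> \<le> exp (1 / 2 - l\<^sup>2)"
  proof -
    have "D \<ge> 0" unfolding D using y b by simp
    moreover have "l\<^sup>2 \<le> l ^ 4" using l1 by (intro power_increasing) auto
    ultimately have "(D + 1) * l\<^sup>2 \<le> (D + 1) * l ^ 4" by (intro mult_left_mono) auto
    then show ?thesis by (simp add: algebra_simps)
  qed
  finally show ?thesis unfolding l_def .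
qed

lemma (in prob_space) distributed_observation:
  assumes G: "real_distribution G"
    and model: "distributed M (G \<Otimes>\<^sub>M lborel) (\<lambda>\<omega>. (\<theta> \<omega>, X \<omega>)) (\<lambda>(t, x). ennreal (normal_density t 1 x))"
  shows "distributed M lborel X (\<lambda>x. ennreal (p_dens G x))"
proof -
  interpret G: real_distribution G by (rule G)
  have "distributed M lborel X (\<lambda>x. \<integral>\<^sup>+t. (case (t, x) of (t, x) \<Rightarrow> ennreal (normal_density t 1 x)) \<partial>G)"
    by (rule distr_marginal2[OF _ _ model]) (unfold_locales)
  moreover have "(\<integral>\<^sup>+t. (case (t, x) of (t, x) \<Rightarrow> ennreal (normal_density t 1 x)) \<partial>G) = ennreal (p_dens G x)" for x
    unfolding p_dens_def ennreal_normal_mixture[OF G zero_less_one]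
    by (simp add: normal_density_def)
  ultimately show ?thesis by simp
qed

lemma (in prob_space) prob_abs_gt_distributed:
  fixes p :: "real \<Rightarrow> real"
  assumes distr: "distributed M lborel X (\<lambda>x. ennreal (p x))" and p: "\<And>x. 0 \<le> p x"
  shows "prob {\<omega> \<in> space M. \<bar>X \<omega>\<bar> > t} = (\<integral>x. indicator {x. \<bar>x\<bar> > t} x * p x \<partial>lborel)"
proof -
  have [measurable]: "{x::real. \<bar>x\<bar> > t} \<in> sets borel" by measurable
  have X: "X \<in> borel_measurable M" using distributed_measurable[OF distr] by simp
  have "prob {\<omega> \<in> space M. \<bar>X \<omega>\<bar> > t} = (\<integral>\<omega>. indicator {\<omega> \<in> space M. \<bar>X \<omega>\<bar> > t} \<omega> \<partial>M)"
    using X by (simp add: Int_absorb2[OF Collect_restrict])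
  also have "\<dots> = (\<integral>\<omega>. indicator {x. \<bar>x\<bar> > t} (X \<omega>) \<partial>M)"
    by (rule Bochner_Integration.integral_cong) (auto simp: indicator_def)
  also have "\<dots> = (\<integral>x. p x * indicator {x. \<bar>x\<bar> > t} x \<partial>lborel)"
    using p by (intro distributed_integral[OF distr, symmetric]) auto
  finally show ?thesis by (simp add: mult.commute)
qed

text \<open>The bound on the exceptional probability tends to zero, which is why one constant \<open>B\<close> serves
  every \<open>\<epsilon>\<close>.\<close>

lemma (in prob_space) npmle_L2_rate:
  fixes p :: "real \<Rightarrow> real"
  assumes X: "indep_vars (\<lambda>_. borel) X UNIV" and distr: "\<And>i. distributed M lborel (X i) (\<lambda>x. ennreal (p x))"
    and p: "integrable lborel p" "(\<integral>x. p x \<partial>lborel) = 1" "\<And>x. 0 < p x" "\<And>x. p x \<le> 1"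
    and c2: "c2 > 0"
    and tail: "\<And>t. t > 0 \<Longrightarrow> (\<integral>x. indicator {x. \<bar>x\<bar> > t} x * p x \<partial>lborel) \<le> c1 * exp (- c2 * t)"
    and L: "L > 0" and H0: "H0 \<in> borel_probs {-L..L}"
    and min: "\<And>H. H \<in> borel_probs {-L..L} \<Longrightarrow> KL p (f_dens c H0) \<le> KL p (f_dens c H)"
    and C: "C > 0" "\<And>x. f_dens c H0 x \<le> C * p x"
    and npmle: "\<And>n \<omega>. n \<ge> 1 \<Longrightarrow> \<omega> \<in> space M \<Longrightarrow> is_npmle c L n (\<lambda>i. X i \<omega>) (Hhat n \<omega>)"
  obtains B where "B > 0" and "\<And>\<epsilon>. \<epsilon> > 0 \<Longrightarrow> \<forall>\<^sub>F n in sequentially. \<exists>A\<in>sets M. prob A \<le> \<epsilon> \<and>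
      {\<omega> \<in> space M. (\<integral>x. (f_dens c (Hhat n \<omega>) x - f_dens c H0 x)\<^sup>2 \<partial>lborel) > B * q_rate n} \<subseteq> A"
proof -
  let ?s = "sigma_star c"
  note sp = sigma_star_pos[of c]
  have mom: "integrable lborel (\<lambda>x. p x * x\<^sup>2)"
    by (rule second_moment_of_exponential_tail[OF p(1) _ c2 tail]) (auto simp: p less_imp_le)
  have p_nn: "(\<integral>\<^sup>+x. ennreal (p x) \<partial>lborel) = 1"
    using p by (subst nn_integral_eq_integral) (auto simp: less_imp_le)
  have pm: "p \<in> borel_measurable borel" using p(1) by auto
  define I where "I H = (\<integral>x. (f_dens c H x - f_dens c H0 x)\<^sup>2 \<partial>lborel)" for H
  have sqrt_ratio: "(\<integral>\<^sup>+x. ennreal (p x * sqrt (f_dens c H x / f_dens c H0 x)) \<partial>lborel)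
      \<le> ennreal (exp (- I H / (8 * C)))" if H: "H \<in> borel_probs {-L..L}" for H
  proof -
    note rd = borel_probsD(1)[OF H] and rd0 = borel_probsD(1)[OF H0]
    have "f_dens c K x \<le> 1" if "real_distribution K" for K x
      unfolding f_dens_def
      using normal_mixture_le_peak[OF that sp] normal_density_peak_le_1[OF sigma_star_ge_1] by (rule order_trans)
    then show ?thesis
      unfolding I_def
      using KL_projection_ratio_le_1[OF p mom H0 H L sp, folded f_dens_def, OF min]
        measurable_normal_mixture[OF rd sp, folded f_dens_def] measurable_normal_mixture[OF rd0 sp, folded f_dens_def]
        normal_mixture_pos[OF rd sp, folded f_dens_def] normal_mixture_pos[OF rd0 sp, folded f_dens_def]
        integral_mixture_diff_sq(2)[OF rd rd0 sp, folded f_dens_def] rd rd0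
      by (intro nn_integral_sqrt_ratio_le pm p(3) p_nn C) auto
  qed
  define y where "y = 2 / c2 * L / ?s\<^sup>2"
  define b where "b = L\<^sup>2 / (2 * ?s\<^sup>2)"
  define D where "D = (5 * y + b + 4) * (2 * y + b + 4)"
  have yb: "y \<ge> 0" "b \<ge> 0" using c2 L by (simp_all add: y_def b_def)
  have D0: "D \<ge> 0" using yb by (simp add: D_def)
  define B where "B = 8 * C * (D + 1)"
  define \<delta> where "\<delta> n = c1 / real n + exp (1 / 2 - (ln (real n))\<^sup>2)" for n :: nat
  have lim: "\<delta> \<longlonglongrightarrow> 0" unfolding \<delta>_def by real_asymp
  have event: "\<exists>A\<in>sets M. prob A \<le> \<delta> n \<and> {\<omega> \<in> space M. I (Hhat n \<omega>) > B * q_rate n} \<subseteq> A"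
    if n: "n \<ge> 3" for n
  proof -
    have n1: "n \<ge> 1" and n0: "real n > 0" using n by auto
    have ln0: "ln (real n) > 0" using n by simp
    define R where "R = 2 / c2 * ln (real n)"
    have R: "R > 0" using c2 ln0 by (simp add: R_def)
    define N where "N = nat \<lceil>5 * (y * ln (real n)) + b + ln (4 * real n)\<rceil>"
    define S where "S = {H \<in> borel_probs {-L..L}. I H > B * q_rate n}"
    define d where "d = B * q_rate n / (8 * C)"
    have Y: "y * ln (real n) = R * L / ?s\<^sup>2" by (simp add: y_def R_def)
    have Nge: "5 * (y * ln (real n)) + b + ln (4 * real n) \<le> real N" unfolding N_def by linarith
    have out: "prob {\<omega> \<in> space M. \<bar>X i \<omega>\<bar> > R} \<le> c1 * exp (- c2 * R)" for i
      using tail[OF R] p(3) by (subst prob_abs_gt_distributed[OF distr]) (auto simp: less_imp_le)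
    have ratio_S: "(\<integral>\<^sup>+x. ennreal (p x * sqrt (f_dens c H x / f_dens c H0 x)) \<partial>lborel) \<le> ennreal (exp (- d))"
      if "H \<in> S" for H
    proof -
      have "exp (- I H / (8 * C)) \<le> exp (- d)"
        unfolding d_def using that C(1) by (simp add: S_def divide_right_mono)
      then show ?thesis using sqrt_ratio[of H] that by (auto simp: S_def intro: order_trans ennreal_leI)
    qed
    obtain A where A: "A \<in> sets M" "{\<omega> \<in> space M. Hhat n \<omega> \<in> S} \<subseteq> A"
      "prob A \<le> real n * (c1 * exp (- c2 * R))
        + (8 * real n * exp (2 * (y * ln (real n)) + b)) ^ N * (exp (1 / 2) * exp (- real n * d))"
      by (rule npmle_far_from_projection[where S = S, OF X distr less_imp_le[OF p(3)] out L less_imp_le[OF R] n1 H0 _ ratio_S Y b_def Nge npmle[OF n1]])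
        (auto simp: S_def)
    have "- c2 * R = - ln (real n) + - ln (real n)" using c2 by (simp add: R_def)
    then have "exp (- c2 * R) = inverse (real n) * inverse (real n)"
      using n0 by (simp only: exp_add exp_minus exp_ln)
    then have "real n * (c1 * exp (- c2 * R)) = c1 / real n" using n0 by (simp add: divide_inverse)
    moreover have "d = (D + 1) * ln (real n) ^ 4 / real n"
      unfolding d_def B_def q_rate_def using C(1) by simp
    then have "real n * d = (D + 1) * ln (real n) ^ 4" using n0 by simp
    then have "- real n * d = - (D + 1) * ln (real n) ^ 4" by (simp only: mult_minus_left)
    ultimately have "prob A \<le> \<delta> n"
      using A(3) union_bound_exponent_le[OF yb n D_def N_def] unfolding \<delta>_def by simp
    moreover have "{\<omega> \<in> space M. I (Hhat n \<omega>) > B * q_rate n} \<subseteq> A"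
      using A(2) npmle[OF n1] by (auto simp: S_def is_npmle_def is_arg_max_def)
    ultimately show ?thesis using A(1) by blast
  qed
  show ?thesis
  proof
    show "B > 0" using C(1) D0 by (simp add: B_def)
    fix \<epsilon> :: real assume "\<epsilon> > 0"
    then have "\<forall>\<^sub>F n in sequentially. \<delta> n < \<epsilon>" using lim by (rule order_tendstoD(2)[rotated])
    then show "\<forall>\<^sub>F n in sequentially. \<exists>A\<in>sets M. prob A \<le> \<epsilon> \<and>
      {\<omega> \<in> space M. (\<integral>x. (f_dens c (Hhat n \<omega>) x - f_dens c H0 x)\<^sup>2 \<partial>lborel) > B * q_rate n} \<subseteq> A"
      using eventually_ge_at_top[of 3] unfolding I_def[symmetric]
    proof eventually_elim
      case (elim n)
      from event[OF elim(2)] obtain A where "A \<in> sets M" "prob A \<le> \<delta> n"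
        "{\<omega> \<in> space M. I (Hhat n \<omega>) > B * q_rate n} \<subseteq> A" by blast
      with elim(1) show ?case by (intro bexI[of _ A] conjI) linarith+
    qed
  qed
qed

section \<open>Rates for the prior density and the posterior\<close>

lemma bigO_p_transfer:
  assumes base: "\<And>\<epsilon>. \<epsilon> > 0 \<Longrightarrow> \<forall>\<^sub>F n in sequentially. \<exists>A\<in>sets M. measure M A \<le> \<epsilon> \<and> {\<omega> \<in> space M. \<not> P n \<omega>} \<subseteq> A"
    and le: "\<forall>\<^sub>F n in sequentially. \<forall>\<omega>\<in>space M. P n \<omega> \<longrightarrow> \<bar>Y n \<omega>\<bar> \<le> K * a n"
  shows "bigO_p M Y a"
  unfolding bigO_p_def
proof (intro allI impI exI)
  fix \<epsilon> :: real assume "\<epsilon> > 0"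
  from base[OF this] le show "\<forall>\<^sub>F n in sequentially. \<exists>A\<in>sets M.
       measure M A \<le> \<epsilon> \<and> {\<omega> \<in> space M. \<bar>Y n \<omega>\<bar> > K * a n} \<subseteq> A"
  proof eventually_elim
    case (elim n)
    then obtain A where "A \<in> sets M" "measure M A \<le> \<epsilon>" "{\<omega> \<in> space M. \<not> P n \<omega>} \<subseteq> A" by blast
    with elim(2) show ?case by (intro bexI[of _ A]) (auto simp: not_le[symmetric])
  qed
qed

text \<open>The cut-off \<open>R\<close> is of order \<open>(ln (inverse q)) powr (1/2)\<close>, so that the Gaussian tails of the
  prior densities are of order \<open>q powr (a / 2)\<close>; Cauchy--Schwarz on \<open>[-R, R]\<close> then costs the factor
  \<open>R powr (1/2)\<close>, which is the logarithm in the rate for the posterior.\<close>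

lemma wTV_le_of_L2:
  assumes H: "H \<in> borel_probs {-L..L}" and K: "K \<in> borel_probs {-L..L}" and c: "c > 0" and a: "a > 0"
    and q: "0 < q" "q < 1" and large: "2 * L \<le> sqrt (4 * c\<^sup>2 * a * ln (inverse q))" "ln (inverse q) \<ge> 1"
    and B: "(\<integral>x. (g_dens c H x - g_dens c K x)\<^sup>2 \<partial>lborel) \<le> B * q powr a"
  shows "wTV c H K \<le> (B / 2 + 2 * c * sqrt a + 8) * (q powr (a / 2) * ln (inverse q) powr (1 / 4))"
proof -
  define l where "l = ln (inverse q)"
  define w where "w = l powr (1 / 4)"
  define k where "k = q powr (a / 2)"
  define R where "R = 2 * c * sqrt a * w\<^sup>2"
  have l1: "l \<ge> 1" using large by (simp add: l_def)
  have w1: "w \<ge> 1" unfolding w_def using l1 by (intro ge_one_powr_ge_zero) auto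
  have w2: "w\<^sup>2 = sqrt l" unfolding w_def using l1 by (simp add: power2_eq_square powr_add[symmetric] powr_half_sqrt)
  have k0: "k > 0" using q by (simp add: k_def)
  have k2: "q powr a = k * k" using q by (simp add: k_def powr_add[symmetric])
  have R_eq: "R = sqrt (4 * c\<^sup>2 * a * l)"
    unfolding R_def w2 using c a by (simp add: real_sqrt_mult)
  have R0: "R > 0" unfolding R_def using c a w1 by simp
  have "R\<^sup>2 = 4 * c\<^sup>2 * a * l" unfolding R_eq using a l1 by simp
  then have "- R\<^sup>2 / (8 * c\<^sup>2) = a / 2 * ln q" using c q by (simp add: l_def ln_inverse)
  then have E: "exp (- R\<^sup>2 / (8 * c\<^sup>2)) = k" using q by (simp only: k_def powr_def) simp
  have "wTV c H K \<le> (\<integral>x. \<bar>g_dens c H x - g_dens c K x\<bar> \<partial>lborel)"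
    by (rule wTV_le_L1[OF borel_probsD(1)[OF H] borel_probsD(1)[OF K] c])
  \<comment> \<open>The free parameter \<open>w / k\<close> balances the first two terms: both become multiples of \<open>k * w\<close>.\<close>
  also have "\<dots> \<le> (w / k) / 2 * (\<integral>x. (g_dens c H x - g_dens c K x)\<^sup>2 \<partial>lborel) + R / (w / k) + 8 * exp (- R\<^sup>2 / (8 * c\<^sup>2))"
    unfolding g_dens_def using w1 k0 large R0
    by (intro mixture_L1_le_L2[OF H K c]) (auto simp: R_eq l_def)
  also have "\<dots> \<le> (w / k) / 2 * (B * (k * k)) + R / (w / k) + 8 * exp (- R\<^sup>2 / (8 * c\<^sup>2))"
    using B w1 k0 unfolding k2 by (intro add_right_mono mult_left_mono) auto
  also have "\<dots> = B / 2 * (k * w) + 2 * c * sqrt a * (k * w) + 8 * k"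
    unfolding E unfolding R_def using w1 k0 by (simp add: field_simps power2_eq_square)
  also have "\<dots> \<le> B / 2 * (k * w) + 2 * c * sqrt a * (k * w) + 8 * (k * w)"
    using w1 k0 by simp
  finally show ?thesis by (simp add: k_def w_def l_def algebra_simps)
qed

theorem theorem2p5:
  fixes M :: "'a measure"
    and G :: "real measure"
    and \<theta> X :: "nat \<Rightarrow> 'a \<Rightarrow> real"
    and c L c1 c2 C :: real
    and Ht :: "real measure"
    and Hhat :: "nat \<Rightarrow> 'a \<Rightarrow> real measure"
  assumes "prob_space M"
    and "G \<in> borel_probs UNIV"
    and indep: "prob_space.indep_vars M (\<lambda>_. borel \<Otimes>\<^sub>M borel) (\<lambda>i \<omega>. (\<theta> i \<omega>, X i \<omega>)) UNIV"
    and model: "\<And>i. distributed M (G \<Otimes>\<^sub>M lborel) (\<lambda>\<omega>. (\<theta> i \<omega>, X i \<omega>))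
                      (\<lambda>(t, x). ennreal (normal_density t 1 x))"
    and "c > 0" and "L > 0"
    and "c1 > 0" and "c2 > 0"
    and tail: "\<And>t. t > 0 \<Longrightarrow>
                 (\<integral>x. indicator {x. \<bar>x\<bar> > t} x * p_dens G x \<partial>lborel) \<le> c1 * exp (- c2 * t)"
    and Ht: "Ht \<in> borel_probs {-L..L}"
    and argmin: "is_arg_min (KL (p_dens G)) (\<lambda>f. f \<in> F_class c L) (f_dens c Ht)"
    and "C > 0"
    and ratio: "\<And>x. f_dens c Ht x / p_dens G x \<le> C"
    and npmle: "\<And>n \<omega>. n \<ge> 1 \<Longrightarrow> \<omega> \<in> space M \<Longrightarrow> is_npmle c L n (\<lambda>i. X i \<omega>) (Hhat n \<omega>)"
  shows "bigO_p M (\<lambda>n \<omega>. (L2norm (\<lambda>t. g_dens c (Hhat n \<omega>) t - g_dens c Ht t))\<^sup>2)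
           (\<lambda>n. q_rate n powr alpha_star c)
       \<and> bigO_p M (\<lambda>n \<omega>. wTV c (Hhat n \<omega>) Ht)
           (\<lambda>n. q_rate n powr (alpha_star c / 2) * (ln (inverse (q_rate n))) powr (1/4))"
proof -
  interpret prob_space M by fact
  let ?s = "sigma_star c" and ?p = "p_dens G" and ?a = "alpha_star c"
  have G: "real_distribution G" using \<open>G \<in> borel_probs UNIV\<close> by (rule borel_probsD)
  have X: "indep_vars (\<lambda>_. borel) X UNIV"
    using indep_vars_compose2[OF indep, of "\<lambda>_. snd" "\<lambda>_. borel"] by simp
  have distr: "distributed M lborel (X i) (\<lambda>x. ennreal (?p x))" for i
    by (rule distributed_observation[OF G model])
  have p_pos: "?p x > 0" for x unfolding p_dens_def by (rule normal_mixture_pos[OF G]) simp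
  have p_le: "?p x \<le> 1" for x
    unfolding p_dens_def by (rule order_trans[OF normal_mixture_le_peak[OF G] normal_density_peak_le_1]) simp_all
  have p_int: "integrable lborel ?p" "(\<integral>x. ?p x \<partial>lborel) = 1"
    unfolding p_dens_def by (rule integrable_normal_mixture[OF G] integral_normal_mixture[OF G]; simp)+
  have min: "KL ?p (f_dens c Ht) \<le> KL ?p (f_dens c H)" if "H \<in> borel_probs {-L..L}" for H
    using argmin that by (auto simp: is_arg_min_def F_class_def not_less)
  have dom: "f_dens c Ht x \<le> C * ?p x" for x
    using ratio[of x] p_pos[of x] by (simp add: pos_divide_le_eq)
  obtain B where B: "B > 0" and event: "\<And>\<epsilon>. \<epsilon> > 0 \<Longrightarrow> \<forall>\<^sub>F n in sequentially. \<exists>A\<in>sets M. prob A \<le> \<epsilon> \<and>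
      {\<omega> \<in> space M. (\<integral>x. (f_dens c (Hhat n \<omega>) x - f_dens c Ht x)\<^sup>2 \<partial>lborel) > B * q_rate n} \<subseteq> A"
    using npmle_L2_rate[OF X distr p_int p_pos p_le \<open>c2 > 0\<close> tail \<open>L > 0\<close> Ht min \<open>C > 0\<close> dom npmle] by blast
  define P where "P n \<omega> \<longleftrightarrow> (\<integral>x. (f_dens c (Hhat n \<omega>) x - f_dens c Ht x)\<^sup>2 \<partial>lborel) \<le> B * q_rate n" for n \<omega>
  have event': "\<forall>\<^sub>F n in sequentially. \<exists>A\<in>sets M. prob A \<le> \<epsilon> \<and> {\<omega> \<in> space M. \<not> P n \<omega>} \<subseteq> A" if "\<epsilon> > 0" for \<epsilon>
    using event[OF that] by (simp add: P_def not_le)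
  define B' where "B' = B + 4 / pi * (\<integral>t. exp (- c\<^sup>2 * t\<^sup>2) \<partial>lborel)"
  have a: "?a > 0" "?a = c\<^sup>2 / ?s\<^sup>2" using \<open>c > 0\<close> sigma_star_pos[of c] by (simp_all add: alpha_star_def)
  have c_le: "c \<le> ?s" unfolding sigma_star_def by (rule real_le_rsqrt) simp
  have Hb: "Hhat n \<omega> \<in> borel_probs {-L..L}" if "n \<ge> 1" "\<omega> \<in> space M" for n \<omega>
    using npmle[OF that] by (simp add: is_npmle_def is_arg_max_def)
  have g_le: "(\<integral>x. (g_dens c (Hhat n \<omega>) x - g_dens c Ht x)\<^sup>2 \<partial>lborel) \<le> B' * q_rate n powr ?a"
    if "n \<ge> 1" "\<omega> \<in> space M" "P n \<omega>" "0 < q_rate n" "q_rate n < 1" for n \<omega>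
    unfolding g_dens_def B'_def a(2)
    using narrower_mixture_diff_sq_le[OF borel_probsD(1)[OF Hb[OF that(1,2)]] borel_probsD(1)[OF Ht] \<open>c > 0\<close> c_le]
      that(3-5) by (simp add: P_def f_dens_def)
  have q_lim: "q_rate \<longlonglongrightarrow> 0" and l_lim: "filterlim (\<lambda>n. ln (inverse (q_rate n))) at_top sequentially"
    unfolding q_rate_def by real_asymp+
  have q1: "\<forall>\<^sub>F n in sequentially. q_rate n < 1" by (rule order_tendstoD(2)[OF q_lim]) simp
  have q0: "\<forall>\<^sub>F n in sequentially. 0 < q_rate n"
    using eventually_ge_at_top[of 2] by eventually_elim (auto simp: q_rate_def)
  have l1: "\<forall>\<^sub>F n in sequentially. max 1 (L\<^sup>2 / (c\<^sup>2 * ?a)) \<le> ln (inverse (q_rate n))"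
    using l_lim unfolding filterlim_at_top by blast
  show ?thesis
  proof
    show "bigO_p M (\<lambda>n \<omega>. (L2norm (\<lambda>t. g_dens c (Hhat n \<omega>) t - g_dens c Ht t))\<^sup>2) (\<lambda>n. q_rate n powr ?a)"
    proof (rule bigO_p_transfer[where P = P and K = B', OF event'])
      show "\<forall>\<^sub>F n in sequentially. \<forall>\<omega>\<in>space M. P n \<omega> \<longrightarrow>
          \<bar>(L2norm (\<lambda>t. g_dens c (Hhat n \<omega>) t - g_dens c Ht t))\<^sup>2\<bar> \<le> B' * q_rate n powr ?a"
        using q0 q1 eventually_ge_at_top[of 1]
      proof eventually_elim
        case (elim n)
        then show ?case using g_le[of n] by (simp add: L2norm_def integral_nonneg_AE)
      qed
    qed
    show "bigO_p M (\<lambda>n \<omega>. wTV c (Hhat n \<omega>) Ht)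
           (\<lambda>n. q_rate n powr (?a / 2) * (ln (inverse (q_rate n))) powr (1/4))"
    proof (rule bigO_p_transfer[where P = P and K = "B' / 2 + 2 * c * sqrt ?a + 8", OF event'])
      show "\<forall>\<^sub>F n in sequentially. \<forall>\<omega>\<in>space M. P n \<omega> \<longrightarrow> \<bar>wTV c (Hhat n \<omega>) Ht\<bar>
          \<le> (B' / 2 + 2 * c * sqrt ?a + 8) * (q_rate n powr (?a / 2) * (ln (inverse (q_rate n))) powr (1/4))"
        using q0 q1 l1 eventually_ge_at_top[of 1]
      proof eventually_elim
        case (elim n)
        have "L\<^sup>2 \<le> c\<^sup>2 * ?a * ln (inverse (q_rate n))"
          using elim(3) \<open>c > 0\<close> a(1) by (simp add: pos_divide_le_eq mult.commute)
        then have "(2 * L)\<^sup>2 \<le> 4 * c\<^sup>2 * ?a * ln (inverse (q_rate n))"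
          by (simp add: power_mult_distrib)
        then have "2 * L \<le> sqrt (4 * c\<^sup>2 * ?a * ln (inverse (q_rate n)))" by (rule real_le_rsqrt)
        then show ?case
          using wTV_le_of_L2[OF Hb[OF elim(4)] Ht \<open>c > 0\<close> a(1) elim(1,2)] elim g_le[of n]
            wTV_nonneg[OF borel_probsD(1)[OF Ht], of c "Hhat n _"]
          by (auto simp: abs_of_nonneg)
      qed
    qed
  qed
qed

end
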